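(* Let $N\in\{1,2\}$ and let $B=(\beta_{ij})_{ij}\in S(n)$, $n\ge2$, be such that $\beta_{ii}\ge0$ for $i=1,\dots,n$. Then the system $$-\Delta u_i=\sum_{j=1}^n\beta_{ij}u_j^2u_i,\qquad u_1,\dots,u_n\ge 0\qquad\text{in }\mathbb{R}^N\qquad(i=1,\dots,n)$$ admits a nontrivial solution if and only if $B$ is not strictly copositive.
   Context: $S(n)$ denotes the space of symmetric $n\times n$ matrices with real coefficients, and $C^n_+=\{c\in\mathbb{R}^n: c_i\ge 0 \text{ for all } i\}$. A matrix $B=(\beta_{ij})_{ij}\in S(n)$ is strictly copositive if $\sum_{i,j=1}^n\beta_{ij}c_ic_j>0$ for all $c\in C^n_+\setminus\{0\}$. A solution $u=(u_1,\dots,u_n)$ of the system (all components nonnegative) is called nontrivial if $u_i\not\equiv 0$ for at least one $i$. *)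

theory Defs
  imports "HOL-Analysis.Analysis"
begin

definition nonneg_orthant :: "(real ^ 'n) set" where
  "nonneg_orthant = {c. \<forall>i. 0 \<le> c $ i}"

definition strictly_copositive :: "real ^ 'n ^ 'n \<Rightarrow> bool" where
  "strictly_copositive B \<longleftrightarrow>
     (\<forall>c \<in> nonneg_orthant - {0}. 0 < (\<Sum>i\<in>UNIV. \<Sum>j\<in>UNIV. B $ i $ j * c $ i * c $ j))"

definition partial_deriv :: "'m \<Rightarrow> (real ^ 'm \<Rightarrow> real) \<Rightarrow> real ^ 'm \<Rightarrow> real" where
  "partial_deriv k f x = deriv (\<lambda>t. f (x + t *\<^sub>R axis k 1)) 0"

definition C1_function :: "(real ^ 'm \<Rightarrow> real) \<Rightarrow> bool" where
  "C1_function f \<longleftrightarrow>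
     (\<forall>k. (\<forall>x. (\<lambda>t. f (x + t *\<^sub>R axis k 1)) differentiable (at 0)) \<and>
          continuous_on UNIV (partial_deriv k f))"

definition C2_function :: "(real ^ 'm \<Rightarrow> real) \<Rightarrow> bool" where
  "C2_function f \<longleftrightarrow> C1_function f \<and> (\<forall>k. C1_function (partial_deriv k f))"

definition laplacian :: "(real ^ 'm \<Rightarrow> real) \<Rightarrow> real ^ 'm \<Rightarrow> real" where
  "laplacian f x = (\<Sum>k\<in>UNIV. partial_deriv k (partial_deriv k f) x)"

text \<open>Solutions are understood in the classical sense: every component is twice continuously
  differentiable and the equations hold pointwise on the whole space.\<close>

definition cubic_system_solution ::
    "real ^ 'n ^ 'n \<Rightarrow> ('n \<Rightarrow> real ^ 'm \<Rightarrow> real) \<Rightarrow> bool" where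
  "cubic_system_solution B u \<longleftrightarrow>
     (\<forall>i. C2_function (u i) \<and>
          (\<forall>x. 0 \<le> u i x \<and>
               - laplacian (u i) x = (\<Sum>j\<in>UNIV. B $ i $ j * (u j x)\<^sup>2 * u i x)))"

definition nontrivial :: "('n \<Rightarrow> real ^ 'm \<Rightarrow> real) \<Rightarrow> bool" where
  "nontrivial u \<longleftrightarrow> (\<exists>i. u i \<noteq> (\<lambda>x. 0))"

end

theory Submission
  imports Defs
begin

text \<open>Write \<open>Q c\<close> for the quadratic form of \<open>B\<close>. The two implications have unrelated proofs.

\<^bold>\<open>Strict copositivity excludes solutions.\<close> A component of a solution solves a linear equation
\<open>- \<Delta> u\<^sub>i = V u\<^sub>i\<close> with continuous \<open>V = (\<Sum>j. B\<^sub>i\<^sub>j u\<^sub>j\<^sup>2)\<close>, so by a maximum principle it vanishes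
identically or is positive everywhere (\<open>positivity_propagates\<close>). In the second case
testing with \<open>\<phi>\<^sup>2 / u\<^sub>i\<close> and completing the square gives
\<open>\<integral> V \<phi>\<^sup>2 \<le> \<integral> \<bar>\<nabla>\<phi>\<bar>\<^sup>2\<close> (\<open>positive_supersolution_inequality\<close>). With
\<open>d\<^sub>j = \<integral> u\<^sub>j\<^sup>2 \<phi>\<^sup>2\<close> this reads \<open>(B d)\<^sub>i \<le> \<integral> \<bar>\<nabla>\<phi>\<bar>\<^sup>2\<close> whenever \<open>d\<^sub>i \<noteq> 0\<close>. Multiplying by \<open>d\<^sub>i\<close>,
summing and using \<open>Q d \<ge> \<delta> \<bar>d\<bar>\<^sup>2\<close> bounds \<open>\<bar>d\<bar>\<close> by a multiple of \<open>\<integral> \<bar>\<nabla>\<phi>\<bar>\<^sup>2\<close>. In dimension two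
logarithmic cutoffs make that energy arbitrarily small although they are bounded below on a fixed
square, so all \<open>u\<^sub>j\<close> vanish (\<open>planar_liouville\<close>). The line is reduced to the plane by a dummy variable.

\<^bold>\<open>Failure of strict copositivity produces solutions.\<close> It suffices to find a solution
depending on one real variable. If some \<open>B\<^sub>k\<^sub>k = 0\<close>, the \<open>k\<close>-th unit vector is a constant solution. Otherwise the
equations are Newton's equations for the potential \<open>Q (u\<^sub>1\<^sup>2, ..., u\<^sub>n\<^sup>2) / 4\<close>. Take a set \<open>S\<close> of indices,
minimal among the supports of vectors \<open>c \<ge> 0\<close>, \<open>c \<noteq> 0\<close>, with \<open>Q c \<le> 0\<close>. In the orthant of vectors supported in \<open>S\<close>
the potential is positive on the boundary, except at the origin, but it is nonpositive at some
interior point \<open>q\<close>. Release a particle at rest at a point of the segment from a unit vector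
\<open>e\<^sub>k\<close>, \<open>k \<in> S\<close>, to \<open>q\<close>, scaled by \<open>\<epsilon>\<close>. From \<open>\<epsilon> e\<^sub>k\<close> the particle runs through the origin
and leaves the orthant; from \<open>\<epsilon> q\<close> it has energy at most 0 and cannot cross the boundary. Somewhere in
between there is a transition, and the critical particle either stays in the orthant and in the unit
ball for ever, or it climbs to norm 1 and afterwards touches the boundary of the orthant
(\<open>critical_trajectory\<close>).

In the first case the trajectory, extended evenly in time, is the wanted solution. In the second case
shift time so that norm 1 is reached at time 0 and let \<open>\<epsilon>\<close> tend to 0. The starting point tends to
the equilibrium 0 of the phase space, hence so does the energy, and with it the point of contact, since the
potential is positive on the rest of the boundary; a trajectory needs more and more time to travel between a neighbourhood of an
equilibrium and norm 1. The limit trajectory therefore stays in the orthant and in the unit ball for all times,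
positive and negative, and has norm 1 at time 0 (\<open>exists_trapped\<close>). Since everything
happens in the unit ball, the cubic force may be truncated outside of it, and the flow of a globally
Lipschitz field is enough.\<close>

section \<open>Ordinary differential equations with a globally Lipschitz field\<close>

text \<open>The function \<open>exp (- 2 L t) \<bar>x t - y t\<bar>\<^sup>2\<close> is nonincreasing. This single estimate yields uniqueness as
well as continuous dependence on the initial value.\<close>

lemma lipschitz_ode_forward_dist:
  fixes g :: "'a::real_inner \<Rightarrow> 'a"
  assumes lip: "L-lipschitz_on UNIV g"
    and x: "\<And>t. (x has_vector_derivative g (x t)) (at t)"
    and y: "\<And>t. (y has_vector_derivative g (y t)) (at t)"
    and t: "0 \<le> t"
  shows "dist (x t) (y t) \<le> exp (L * t) * dist (x 0) (y 0)"
proof -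
  define h where "h = (\<lambda>t. exp (- 2 * L * t) * ((x t - y t) \<bullet> (x t - y t)))"
  have dh: "(h has_real_derivative
      exp (- 2 * L * s) * (2 * ((x s - y s) \<bullet> (g (x s) - g (y s))) - 2 * L * ((x s - y s) \<bullet> (x s - y s)))) (at s)" for s
  proof -
    have d: "((\<lambda>t. x t - y t) has_derivative (\<lambda>r. r *\<^sub>R (g (x s) - g (y s)))) (at s)"
      using has_vector_derivative_diff[OF x[of s] y[of s]] by (simp add: has_vector_derivative_def)
    define q where "q = (\<lambda>t. (x t - y t) \<bullet> (x t - y t))"
    have "(q has_real_derivative 2 * ((x s - y s) \<bullet> (g (x s) - g (y s)))) (at s)"
      unfolding q_def has_field_derivative_def
      by (rule has_derivative_eq_rhs[OF has_derivative_inner[OF d d]])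
        (auto simp: fun_eq_iff inner_commute algebra_simps)
    then have "((\<lambda>t. exp (- 2 * L * t) * q t) has_real_derivative
        exp (- 2 * L * s) * (2 * ((x s - y s) \<bullet> (g (x s) - g (y s))) - 2 * L * q s)) (at s)"
      by (auto intro!: derivative_eq_intros simp: algebra_simps)
    then show ?thesis by (simp only: h_def q_def)
  qed
  have "h t \<le> h 0"
  proof (rule DERIV_nonpos_imp_nonincreasing[OF t])
    fix s
    have "(x s - y s) \<bullet> (g (x s) - g (y s)) \<le> norm (x s - y s) * norm (g (x s) - g (y s))"
      by (rule norm_cauchy_schwarz)
    also have "\<dots> \<le> norm (x s - y s) * (L * norm (x s - y s))"
      using lipschitz_on_normD[OF lip, of "x s" "y s"] by (intro mult_left_mono) auto
    also have "\<dots> = L * ((x s - y s) \<bullet> (x s - y s))"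
      by (simp add: power2_norm_eq_inner[symmetric] power2_eq_square)
    finally have "exp (- 2 * L * s) * (2 * ((x s - y s) \<bullet> (g (x s) - g (y s))) - 2 * L * ((x s - y s) \<bullet> (x s - y s))) \<le> 0"
      by (intro mult_nonneg_nonpos) auto
    with dh[of s] show "\<exists>D. (h has_real_derivative D) (at s) \<and> D \<le> 0" by blast
  qed
  then have "(x t - y t) \<bullet> (x t - y t) \<le> exp (2 * L * t) * ((x 0 - y 0) \<bullet> (x 0 - y 0))"
    by (simp add: h_def exp_minus field_simps)
  then have "(norm (x t - y t))\<^sup>2 \<le> (exp (L * t) * norm (x 0 - y 0))\<^sup>2"
    by (simp add: power2_norm_eq_inner power_mult_distrib exp_double[symmetric] mult.assoc)
  then show ?thesis unfolding dist_norm
    by (rule power2_le_imp_le) simp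
qed

lemma reversed_solution:
  assumes "(x has_vector_derivative g (x (- t))) (at (- t))"
  shows "((\<lambda>t. x (- t)) has_vector_derivative - g (x (- t))) (at t)"
proof -
  have "(x \<circ> uminus has_vector_derivative (-1) *\<^sub>R g (x (- t))) (at t)"
    by (rule vector_diff_chain_at) (auto intro!: derivative_eq_intros assms)
  then show ?thesis by (simp add: o_def)
qed

lemma lipschitz_uminus_field:
  fixes g :: "'a::real_normed_vector \<Rightarrow> 'a"
  assumes "L-lipschitz_on UNIV g"
  shows "L-lipschitz_on UNIV (\<lambda>x. - g x)"
  using assms by (auto simp: lipschitz_on_def dist_minus)

lemma lipschitz_ode_dist:
  fixes g :: "'a::real_inner \<Rightarrow> 'a"
  assumes lip: "L-lipschitz_on UNIV g"
    and x: "\<And>t. (x has_vector_derivative g (x t)) (at t)"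
    and y: "\<And>t. (y has_vector_derivative g (y t)) (at t)"
  shows "dist (x t) (y t) \<le> exp (L * \<bar>t\<bar>) * dist (x 0) (y 0)"
proof (cases "0 \<le> t")
  case True
  then show ?thesis using lipschitz_ode_forward_dist[OF lip x y, of t] by simp
next
  case False
  have "dist ((\<lambda>t. x (- t)) (- t)) ((\<lambda>t. y (- t)) (- t))
      \<le> exp (L * (- t)) * dist ((\<lambda>t. x (- t)) 0) ((\<lambda>t. y (- t)) 0)"
    by (rule lipschitz_ode_forward_dist[OF lipschitz_uminus_field[OF lip]])
      (use False in \<open>auto intro: reversed_solution x y\<close>)
  then show ?thesis using False by simp
qed

text \<open>Picard iteration on the whole half-line at once: the unknown is \<open>y t = exp (- K t) x t\<close> with
\<open>K > L\<close>. In the supremum norm of \<open>y\<close> the integral operator contracts by the factor \<open>L / K\<close>, and it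
preserves boundedness because \<open>g\<close> grows at most linearly.\<close>

lemma lipschitz_ode_forward_exists:
  fixes g :: "'a::euclidean_space \<Rightarrow> 'a"
  assumes lip: "L-lipschitz_on UNIV g"
  shows "\<exists>x. x 0 = a \<and> (\<forall>t\<ge>0. (x has_vector_derivative g (x t)) (at t within {0..}))"
proof -
  define K where "K = L + 1"
  have L: "0 \<le> L" by (rule lipschitz_on_nonneg[OF lip])
  have K: "0 < K" "L < K" using L by (auto simp: K_def)
  have contg: "continuous_on UNIV g" by (rule lipschitz_on_continuous_on[OF lip])
  define F where "F = (\<lambda>(y :: real \<Rightarrow>\<^sub>C 'a) s. g (exp (K * s) *\<^sub>R y s))"
  have contF: "continuous_on X (F y)" for y X
    unfolding F_def by (intro continuous_on_compose2[OF contg] continuous_intros) auto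
  have intF: "F y integrable_on {0..t}" for y t
    by (intro integrable_continuous_real contF)
  define J where "J = (\<lambda>y t. integral {0..t} (F y))"
  have expint: "((\<lambda>s. c * exp (K * s)) has_integral c * (exp (K * t) - 1) / K) {0..t}"
    if "0 \<le> t" for c t
  proof -
    have "((\<lambda>s. c * exp (K * s)) has_integral (c * exp (K * t) / K - c * exp (K * 0) / K)) {0..t}"
      by (rule fundamental_theorem_of_calculus)
        (use that K in \<open>auto intro!: derivative_eq_intros simp: has_real_derivative_iff_has_vector_derivative[symmetric]\<close>)
    then show ?thesis by (simp add: diff_divide_distrib right_diff_distrib)
  qed
  \<comment> \<open>Bounded continuous functions live on the whole line here, so negative times are mapped to 0.\<close>
  define P where "P = (\<lambda>y t. exp (- K * max 0 t) *\<^sub>R (a + J y (max 0 t)))"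
  have Jbound: "norm (J y t) \<le> (norm (g 0) + L * B) / K * exp (K * t)"
    if t: "0 \<le> t" and B: "\<And>s. norm (y s) \<le> B" for y :: "real \<Rightarrow>\<^sub>C 'a" and t B
  proof -
    have B0: "0 \<le> B" using B[of 0] norm_ge_zero order_trans by blast
    have "norm (J y t) \<le> integral {0..t} (\<lambda>s. (norm (g 0) + L * B) * exp (K * s))"
      unfolding J_def
    proof (rule integral_norm_bound_integral[OF intF])
      show "(\<lambda>s. (norm (g 0) + L * B) * exp (K * s)) integrable_on {0..t}"
        using expint[OF t] by blast
      fix s assume s: "s \<in> {0..t}"
      have "norm (F y s - g 0) \<le> L * norm (exp (K * s) *\<^sub>R y s)"
        using lipschitz_on_normD[OF lip, of "exp (K * s) *\<^sub>R y s" 0] by (simp add: F_def)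
      also have "\<dots> \<le> L * (exp (K * s) * B)"
        using B[of s] L by (intro mult_left_mono) auto
      finally have "norm (F y s) \<le> norm (g 0) * 1 + L * B * exp (K * s)"
        using norm_triangle_sub[of "F y s" "g 0"] by (simp add: algebra_simps)
      also have "\<dots> \<le> norm (g 0) * exp (K * s) + L * B * exp (K * s)"
        using s K by (intro add_right_mono mult_left_mono) auto
      finally show "norm (F y s) \<le> (norm (g 0) + L * B) * exp (K * s)"
        by (simp add: algebra_simps)
    qed
    also have "\<dots> = (norm (g 0) + L * B) * (exp (K * t) - 1) / K"
      using expint[OF t] by (rule integral_unique)
    also have "\<dots> \<le> (norm (g 0) + L * B) * exp (K * t) / K"
      using K L B0 by (intro divide_right_mono mult_left_mono) auto
    finally show ?thesis by simp
  qed
  have contJ: "continuous_on {0..} (J y)" for y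
    unfolding continuous_on_eq_continuous_within
  proof
    fix t :: real assume t: "t \<in> {0..}"
    have "continuous_on {0..t+1} (J y)"
      unfolding J_def by (rule indefinite_integral_continuous_1[OF intF])
    then have "continuous (at t within {0..t+1}) (J y)"
      using t by (auto simp: continuous_on_eq_continuous_within)
    moreover have "at t within {0..t+1} = at t within {0..}"
      by (rule at_within_nhd[of _ "{..<t+1}"]) auto
    ultimately show "continuous (at t within {0..}) (J y)" by simp
  qed
  have Pb: "P y \<in> bcontfun" for y
  proof -
    have "continuous_on UNIV (P y)"
      unfolding P_def
      by (intro continuous_intros continuous_on_compose2[OF contJ]) auto
    moreover obtain B where B: "\<And>s. norm (y s) \<le> B"
      using bounded_apply_bcontfun[of y] by (auto simp: bounded_iff)
    have "norm (P y t) \<le> norm a + (norm (g 0) + L * B) / K" for t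
    proof -
      let ?t = "max 0 t"
      have "norm (P y t) \<le> exp (- K * ?t) * (norm a * exp (K * ?t) + (norm (g 0) + L * B) / K * exp (K * ?t))"
        unfolding P_def norm_scaleR abs_exp_cancel
      proof (intro mult_left_mono order_trans[OF norm_triangle_ineq] add_mono)
        have "norm a * 1 \<le> norm a * exp (K * ?t)" using K by (intro mult_left_mono) auto
        then show "norm a \<le> norm a * exp (K * ?t)" by simp
      qed (use Jbound[of ?t y B] B in auto)
      also have "\<dots> = norm a + (norm (g 0) + L * B) / K"
        by (simp add: exp_minus field_simps)
      finally show ?thesis .
    qed
    then have "bounded (range (P y))" by (auto simp: bounded_iff)
    ultimately show ?thesis by (simp add: bcontfun_def)
  qed
  define \<Phi> where "\<Phi> = (\<lambda>y. Bcontfun (P y))"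
  have \<Phi>: "apply_bcontfun (\<Phi> y) = P y" for y
    unfolding \<Phi>_def by (rule Bcontfun_inverse[OF Pb])
  have "\<exists>!y. \<Phi> y = y"
  proof (rule banach_fix_type[of "L / K"])
    show "\<forall>y z. dist (\<Phi> y) (\<Phi> z) \<le> L / K * dist y z"
    proof (intro allI dist_bound)
      fix y z and t :: real
      let ?t = "max 0 t"
      have "norm (J y ?t - J z ?t) = norm (integral {0..?t} (\<lambda>s. F y s - F z s))"
        unfolding J_def by (simp add: integral_diff[OF intF intF])
      also have "\<dots> \<le> integral {0..?t} (\<lambda>s. L * dist y z * exp (K * s))"
      proof (rule integral_norm_bound_integral)
        show "(\<lambda>s. F y s - F z s) integrable_on {0..?t}" by (intro integrable_diff intF)
        show "(\<lambda>s. L * dist y z * exp (K * s)) integrable_on {0..?t}"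
          using expint[of ?t] by fastforce
        fix s
        have "norm (F y s - F z s) \<le> L * norm (exp (K * s) *\<^sub>R y s - exp (K * s) *\<^sub>R z s)"
          unfolding F_def by (rule lipschitz_on_normD[OF lip]) auto
        also have "\<dots> = L * (exp (K * s) * dist (y s) (z s))"
          by (simp add: scaleR_diff_right[symmetric] dist_norm)
        also have "\<dots> \<le> L * (exp (K * s) * dist y z)"
          using L by (intro mult_left_mono dist_bounded) auto
        finally show "norm (F y s - F z s) \<le> L * dist y z * exp (K * s)" by (simp add: ac_simps)
      qed
      also have "\<dots> = L * dist y z * (exp (K * ?t) - 1) / K"
        using expint[of ?t] by (intro integral_unique) auto
      also have "\<dots> \<le> L * dist y z * exp (K * ?t) / K"
        using K L by (intro divide_right_mono mult_left_mono) auto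
      finally have "exp (- K * ?t) * norm (J y ?t - J z ?t) \<le> exp (- K * ?t) * (L * dist y z * exp (K * ?t) / K)"
        by (intro mult_left_mono) auto
      also have "\<dots> = L / K * dist y z" by (simp add: exp_minus field_simps)
      finally show "dist (\<Phi> y t) (\<Phi> z t) \<le> L / K * dist y z"
        by (simp add: \<Phi> P_def dist_norm scaleR_diff_right[symmetric])
    qed
  qed (use K L in auto)
  then obtain y where y: "\<Phi> y = y" by blast
  define x where "x = (\<lambda>t. exp (K * t) *\<^sub>R y t)"
  have xJ: "x t = a + J y t" if "0 \<le> t" for t
  proof -
    have "y t = P y t" using \<Phi>[of y] y by simp
    then show ?thesis using that unfolding x_def P_def by (simp add: exp_minus)
  qed
  have Fx: "F y = (\<lambda>s. g (x s))" by (simp add: F_def x_def fun_eq_iff)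
  show ?thesis
  proof (intro exI[of _ x] conjI allI impI)
    show "x 0 = a" using xJ[of 0] by (simp add: J_def)
    fix t :: real assume t: "0 \<le> t"
    have "((\<lambda>u. a + J y u) has_vector_derivative 0 + F y t) (at t within {0..t+1})"
      unfolding J_def
      by (intro has_vector_derivative_add has_vector_derivative_const integral_has_vector_derivative contF)
        (use t in auto)
    then have "(x has_vector_derivative g (x t)) (at t within {0..t+1})"
      by (rule has_vector_derivative_transform[rotated 2, THEN has_vector_derivative_eq_rhs])
         (use t xJ Fx in auto)
    moreover have "at t within {0..t+1} = at t within {0..}"
      by (rule at_within_nhd[of _ "{..<t+1}"]) auto
    ultimately show "(x has_vector_derivative g (x t)) (at t within {0..})" by simp
  qed
qed

text \<open>The solution for negative times is the reversed forward solution of the opposite field; the two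
halves match to first order at 0.\<close>

lemma lipschitz_ode_exists:
  fixes g :: "'a::euclidean_space \<Rightarrow> 'a"
  assumes lip: "L-lipschitz_on UNIV g"
  shows "\<exists>x. x 0 = a \<and> (\<forall>t. (x has_vector_derivative g (x t)) (at t))"
proof -
  obtain x where x: "x 0 = a" "\<And>t. 0 \<le> t \<Longrightarrow> (x has_vector_derivative g (x t)) (at t within {0..})"
    using lipschitz_ode_forward_exists[OF lip] by blast
  obtain y where y: "y 0 = a" "\<And>t. 0 \<le> t \<Longrightarrow> (y has_vector_derivative - g (y t)) (at t within {0..})"
    using lipschitz_ode_forward_exists[OF lipschitz_uminus_field[OF lip]] by blast
  define z where "z = (\<lambda>t. if t \<in> {0..} then x t else y (- t))"
  have yr: "((\<lambda>t. y (- t)) has_vector_derivative g (y (- t))) (at t within {..0})" if "t \<le> 0" for t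
  proof -
    have "(y \<circ> uminus has_vector_derivative (-1) *\<^sub>R (- g (y (- t)))) (at t within {..0})"
    proof (rule vector_diff_chain_within)
      have "uminus ` {..0::real} = {0..}" by auto
      then show "(y has_vector_derivative - g (y (- t))) (at (- t) within uminus ` {..0})"
        using y(2)[of "- t"] that by simp
    qed (auto intro!: derivative_eq_intros)
    then show ?thesis by (simp add: o_def)
  qed
  have "(z has_vector_derivative (if t \<in> {0..} then g (x t) else g (y (- t)))) (at t within UNIV)" for t
    unfolding z_def
  proof (rule has_vector_derivative_If_within_closures[where T = "{..<0}"])
    have c: "closure {..<0::real} = {..0}" by (rule closure_lessThan)
    have u: "insert 0 {..<0::real} = {..0}" "insert 0 {0..} = {0::real..}" "{0..} \<inter> {..0::real} = {0}" by auto
    show "t \<in> {0..} \<union> {..<0}" by auto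
    show "UNIV = {0..} \<union> {..<0::real}" by auto
    show "(x has_vector_derivative g (x t)) (at t within {0..} \<union> closure {0..} \<inter> closure {..<0})"
      if "t \<in> {0..} \<union> closure {0..} \<inter> closure {..<0}"
      using that x(2)[of t] by (simp add: c u)
    show "((\<lambda>t. y (- t)) has_vector_derivative g (y (- t))) (at t within {..<0} \<union> closure {0..} \<inter> closure {..<0})"
      if "t \<in> {..<0} \<union> closure {0..} \<inter> closure {..<0}"
      using that yr[of t] by (simp add: c u)
    show "x t = y (- t)" if "t \<in> closure {0..}" "t \<in> closure {..<0}"
      using that x(1) y(1) by (simp add: c)
    show "g (x t) = g (y (- t))" if "t \<in> closure {0..}" "t \<in> closure {..<0}"
      using that x(1) y(1) by (simp add: c)
  qed
  then have "(z has_vector_derivative g (z t)) (at t)" for t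
    by (simp add: z_def if_distrib[of g])
  moreover have "z 0 = a" by (simp add: z_def x)
  ultimately show ?thesis by blast
qed

section \<open>The truncated Newtonian flow\<close>

text \<open>Truncating each component to the interval from -1 to 1 makes the cubic force globally Lipschitz without
changing it on the unit ball. The truncation is odd, which preserves the symmetry under sign changes of
single components.\<close>

definition clamp1 :: "real \<Rightarrow> real" where
  "clamp1 x = max (- 1) (min 1 x)"

definition clamped_force :: "real ^ 'n ^ 'n \<Rightarrow> real ^ 'n \<Rightarrow> real ^ 'n" where
  "clamped_force B u = (\<chi> i. \<Sum>j\<in>UNIV. B $ i $ j * (clamp1 (u $ j))\<^sup>2 * clamp1 (u $ i))"

definition phase_field :: "real ^ 'n ^ 'n \<Rightarrow> (real ^ 'n) \<times> (real ^ 'n) \<Rightarrow> (real ^ 'n) \<times> (real ^ 'n)" where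
  "phase_field B a = (snd a, - clamped_force B (fst a))"

definition field_lipschitz_const :: "real ^ 'n ^ 'n \<Rightarrow> real" where
  "field_lipschitz_const B = 1 + (\<Sum>i\<in>UNIV. \<Sum>j\<in>UNIV. \<bar>B $ i $ j\<bar> * 3)"

lemma clamp1_bound: "\<bar>clamp1 x\<bar> \<le> 1"
  by (auto simp: clamp1_def)

lemma clamp1_lipschitz: "\<bar>clamp1 x - clamp1 y\<bar> \<le> \<bar>x - y\<bar>"
  by (auto simp: clamp1_def)

lemma clamp1_minus: "clamp1 (- x) = - clamp1 x"
  by (auto simp: clamp1_def)

lemma clamp1_eq: "\<bar>x\<bar> \<le> 1 \<Longrightarrow> clamp1 x = x"
  by (auto simp: clamp1_def)

lemma clamp1_cubic_lipschitz:
  "\<bar>(clamp1 a)\<^sup>2 * clamp1 b - (clamp1 c)\<^sup>2 * clamp1 d\<bar> \<le> 2 * \<bar>a - c\<bar> + \<bar>b - d\<bar>"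
proof -
  let ?a = "clamp1 a" and ?b = "clamp1 b" and ?c = "clamp1 c" and ?d = "clamp1 d"
  have "\<bar>?a\<^sup>2 * ?b - ?c\<^sup>2 * ?d\<bar> = \<bar>(?a - ?c) * ((?a + ?c) * ?b) + ?c\<^sup>2 * (?b - ?d)\<bar>"
    by (simp add: algebra_simps power2_eq_square)
  also have "\<dots> \<le> \<bar>?a - ?c\<bar> * (\<bar>?a + ?c\<bar> * \<bar>?b\<bar>) + ?c\<^sup>2 * \<bar>?b - ?d\<bar>"
    by (rule order_trans[OF abs_triangle_ineq]) (simp add: abs_mult)
  also have "\<dots> \<le> \<bar>a - c\<bar> * (2 * 1) + 1 * \<bar>b - d\<bar>"
    using clamp1_bound[of a] clamp1_bound[of b] clamp1_bound[of c] abs_square_le_1[of ?c]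
    by (intro add_mono mult_mono clamp1_lipschitz) auto
  finally show ?thesis by simp
qed

lemma phase_field_lipschitz: "(field_lipschitz_const B)-lipschitz_on UNIV (phase_field B)"
proof (rule lipschitz_onI)
  let ?K = "\<Sum>i\<in>UNIV. \<Sum>j\<in>UNIV. \<bar>B $ i $ j\<bar> * 3"
  have K: "0 \<le> ?K" by (intro sum_nonneg) auto
  then show "0 \<le> field_lipschitz_const B" by (simp add: field_lipschitz_const_def)
  have force: "norm (clamped_force B u - clamped_force B v) \<le> ?K * norm (u - v)" for u v :: "real ^ 'a"
  proof -
    have c: "\<bar>u $ i - v $ i\<bar> \<le> norm (u - v)" for i
      using component_le_norm_cart[of "u - v" i] by simp
    have "norm (clamped_force B u - clamped_force B v)
        \<le> (\<Sum>i\<in>UNIV. \<bar>(clamped_force B u - clamped_force B v) $ i\<bar>)"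
      by (rule norm_le_l1_cart)
    also have "\<dots> \<le> (\<Sum>i\<in>UNIV. \<Sum>j\<in>UNIV. \<bar>B $ i $ j\<bar> * 3 * norm (u - v))"
    proof (rule sum_mono)
      fix i
      have "\<bar>(clamped_force B u - clamped_force B v) $ i\<bar>
        = \<bar>\<Sum>j\<in>UNIV. B $ i $ j * ((clamp1 (u $ j))\<^sup>2 * clamp1 (u $ i) - (clamp1 (v $ j))\<^sup>2 * clamp1 (v $ i))\<bar>"
        by (simp add: clamped_force_def sum_subtractf right_diff_distrib mult.assoc)
      also have "\<dots> \<le> (\<Sum>j\<in>UNIV. \<bar>B $ i $ j\<bar> * (3 * norm (u - v)))"
      proof (rule order_trans[OF sum_abs sum_mono])
        fix j
        have "\<bar>(clamp1 (u $ j))\<^sup>2 * clamp1 (u $ i) - (clamp1 (v $ j))\<^sup>2 * clamp1 (v $ i)\<bar>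
            \<le> 2 * \<bar>u $ j - v $ j\<bar> + \<bar>u $ i - v $ i\<bar>"
          by (rule clamp1_cubic_lipschitz)
        also have "\<dots> \<le> 2 * norm (u - v) + norm (u - v)"
          by (intro add_mono mult_left_mono c) simp
        finally have "\<bar>(clamp1 (u $ j))\<^sup>2 * clamp1 (u $ i) - (clamp1 (v $ j))\<^sup>2 * clamp1 (v $ i)\<bar> \<le> 3 * norm (u - v)"
          by simp
        then show "\<bar>B $ i $ j * ((clamp1 (u $ j))\<^sup>2 * clamp1 (u $ i) - (clamp1 (v $ j))\<^sup>2 * clamp1 (v $ i))\<bar>
            \<le> \<bar>B $ i $ j\<bar> * (3 * norm (u - v))"
          by (simp add: abs_mult mult_left_mono)
      qed
      finally show "\<bar>(clamped_force B u - clamped_force B v) $ i\<bar> \<le> (\<Sum>j\<in>UNIV. \<bar>B $ i $ j\<bar> * 3 * norm (u - v))"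
        by (simp add: mult.assoc)
    qed
    also have "\<dots> = ?K * norm (u - v)" by (simp add: sum_distrib_right)
    finally show ?thesis .
  qed
  fix a b :: "(real ^ 'a) \<times> (real ^ 'a)"
  have "dist (phase_field B a) (phase_field B b)
      = norm (snd (a - b), - (clamped_force B (fst a) - clamped_force B (fst b)))"
    by (simp add: phase_field_def dist_norm)
  also have "\<dots> \<le> norm (snd (a - b)) + norm (clamped_force B (fst a) - clamped_force B (fst b))"
    by (rule order_trans[OF norm_Pair_le]) (simp only: norm_minus_cancel)
  also have "\<dots> \<le> norm (a - b) + ?K * norm (a - b)"
    using norm_snd_le[of "snd (a - b)" "fst (a - b)", unfolded prod.collapse]
      norm_fst_le[of "fst (a - b)" "snd (a - b)", unfolded prod.collapse] K
    by (intro add_mono order_trans[OF force] mult_left_mono) auto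
  finally show "dist (phase_field B a) (phase_field B b) \<le> field_lipschitz_const B * dist a b"
    by (simp add: field_lipschitz_const_def dist_norm algebra_simps)
qed

definition flow :: "real ^ 'n ^ 'n \<Rightarrow> (real ^ 'n) \<times> (real ^ 'n) \<Rightarrow> real \<Rightarrow> (real ^ 'n) \<times> (real ^ 'n)" where
  "flow B a = (SOME x. x 0 = a \<and> (\<forall>t. (x has_vector_derivative phase_field B (x t)) (at t)))"

abbreviation position :: "real ^ 'n ^ 'n \<Rightarrow> (real ^ 'n) \<times> (real ^ 'n) \<Rightarrow> real \<Rightarrow> real ^ 'n" where
  "position B a t \<equiv> fst (flow B a t)"

abbreviation velocity :: "real ^ 'n ^ 'n \<Rightarrow> (real ^ 'n) \<times> (real ^ 'n) \<Rightarrow> real \<Rightarrow> real ^ 'n" where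
  "velocity B a t \<equiv> snd (flow B a t)"

lemma flow_0 [simp]: "flow B a 0 = a"
  and flow_deriv: "(flow B a has_vector_derivative phase_field B (flow B a t)) (at t)"
proof -
  have "flow B a 0 = a \<and> (\<forall>t. (flow B a has_vector_derivative phase_field B (flow B a t)) (at t))"
    unfolding flow_def by (rule someI_ex[OF lipschitz_ode_exists[OF phase_field_lipschitz]])
  then show "flow B a 0 = a" "(flow B a has_vector_derivative phase_field B (flow B a t)) (at t)"
    by auto
qed

lemma flow_dist: "dist (flow B a t) (flow B b t) \<le> exp (field_lipschitz_const B * \<bar>t\<bar>) * dist a b"
  by (rule ord_le_eq_trans[OF lipschitz_ode_dist[OF phase_field_lipschitz flow_deriv flow_deriv]]) simp

lemma flow_unique:
  assumes "\<And>t. (x has_vector_derivative phase_field B (x t)) (at t)"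
  shows "flow B (x 0) t = x t"
  using lipschitz_ode_dist[OF phase_field_lipschitz assms flow_deriv[of B "x 0"], of t] by simp

lemma flow_add: "flow B (flow B a s) t = flow B a (s + t)"
proof -
  have "((\<lambda>t. flow B a (s + t)) has_vector_derivative phase_field B (flow B a (s + t))) (at t)" for t
  proof -
    have "(flow B a \<circ> (\<lambda>t. s + t) has_vector_derivative 1 *\<^sub>R phase_field B (flow B a (s + t))) (at t)"
      by (rule vector_diff_chain_at) (auto intro!: derivative_eq_intros flow_deriv)
    then show ?thesis by (simp add: o_def)
  qed
  from flow_unique[of "\<lambda>t. flow B a (s + t)" B, OF this] show ?thesis by simp
qed

lemma flow_zero: "flow B (0, 0) t = (0, 0)"
proof -
  have "phase_field B (0, 0) = 0"
    by (simp add: phase_field_def clamped_force_def clamp1_def zero_prod_def vec_eq_iff)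
  then show ?thesis using flow_unique[of "\<lambda>_. (0, 0)" B t] by simp
qed

lemma isCont_flow: "isCont (flow B a) t"
  by (rule has_vector_derivative_continuous[OF flow_deriv])

lemma continuous_on_flow [continuous_intros]:
  "continuous_on X h \<Longrightarrow> continuous_on X (\<lambda>t. flow B a (h t))"
  by (rule continuous_on_compose2[of UNIV]) (auto intro: continuous_at_imp_continuous_on isCont_flow)

text \<open>Limits of trajectories are always taken along convergent initial values and convergent times, so that
compactness is only needed in the phase space and never in a space of functions.\<close>

lemma flow_tendsto:
  assumes a: "a' \<longlonglongrightarrow> a" and t: "t' \<longlonglongrightarrow> t"
  shows "(\<lambda>k. flow B (a' k) (t' k)) \<longlonglongrightarrow> flow B a t"
proof -
  define L where "L = field_lipschitz_const B"
  define f where "f = flow B a"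
  have le: "dist (flow B (a' k) (t' k)) (f t) \<le> exp (L * \<bar>t' k\<bar>) * dist (a' k) a + dist (f (t' k)) (f t)" for k
    unfolding f_def L_def
    using flow_dist[of B "a' k" "t' k" a] dist_triangle[of "flow B (a' k) (t' k)" "flow B a t" "flow B a (t' k)"]
    by linarith
  have "(\<lambda>k. f (t' k)) \<longlonglongrightarrow> f t"
    unfolding f_def by (rule isCont_tendsto_compose[OF isCont_flow t])
  then have "(\<lambda>k. exp (L * \<bar>t' k\<bar>) * dist (a' k) a + dist (f (t' k)) (f t))
      \<longlonglongrightarrow> exp (L * \<bar>t\<bar>) * dist a a + dist (f t) (f t)"
    by (intro tendsto_intros a t)
  then have lim: "(\<lambda>k. exp (L * \<bar>t' k\<bar>) * dist (a' k) a + dist (f (t' k)) (f t)) \<longlonglongrightarrow> 0"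
    by simp
  have "(\<lambda>k. dist (flow B (a' k) (t' k)) (f t)) \<longlonglongrightarrow> 0"
    by (rule tendsto_sandwich[OF _ _ tendsto_const lim]) (intro always_eventually allI, simp add: le)+
  then have "(\<lambda>k. flow B (a' k) (t' k)) \<longlonglongrightarrow> f t" by (rule tendsto_dist_iff[THEN iffD2])
  then show ?thesis by (simp only: f_def)
qed

lemma position_deriv: "(position B a has_vector_derivative velocity B a t) (at t)"
  and velocity_deriv: "(velocity B a has_vector_derivative - clamped_force B (position B a t)) (at t)"
proof -
  have "((\<lambda>t. fst (flow B a t)) has_vector_derivative fst (phase_field B (flow B a t))) (at t)"
    by (rule bounded_linear.has_vector_derivative[OF bounded_linear_fst flow_deriv])
  moreover have "((\<lambda>t. snd (flow B a t)) has_vector_derivative snd (phase_field B (flow B a t))) (at t)"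
    by (rule bounded_linear.has_vector_derivative[OF bounded_linear_snd flow_deriv])
  ultimately show "(position B a has_vector_derivative velocity B a t) (at t)"
    "(velocity B a has_vector_derivative - clamped_force B (position B a t)) (at t)"
    by (simp_all add: phase_field_def)
qed

lemma position_component_deriv:
  "((\<lambda>t. position B a t $ i) has_real_derivative velocity B a t $ i) (at t)"
  unfolding has_real_derivative_iff_has_vector_derivative
  by (rule bounded_linear.has_vector_derivative[OF bounded_linear_vec_nth position_deriv])

lemma velocity_component_deriv:
  "((\<lambda>t. velocity B a t $ i) has_real_derivative - clamped_force B (position B a t) $ i) (at t)"
  unfolding has_real_derivative_iff_has_vector_derivative
  using bounded_linear.has_vector_derivative[OF bounded_linear_vec_nth[of i] velocity_deriv[of B a t]] by simp

text \<open>The equation is of second order without damping, so a particle released from rest retraces its path.\<close>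

lemma flow_even: "flow B (p, 0) (- t) = (position B (p, 0) t, - velocity B (p, 0) t)"
proof -
  let ?x = "\<lambda>t. (position B (p, 0) (- t), - velocity B (p, 0) (- t))"
  have "(?x has_vector_derivative phase_field B (?x t)) (at t)" for t
  proof -
    let ?X = "\<lambda>t. flow B (p, 0) (- t)"
    have "(flow B (p, 0) \<circ> uminus has_vector_derivative (- 1) *\<^sub>R phase_field B (?X t)) (at t)"
      by (rule vector_diff_chain_at) (auto intro!: derivative_eq_intros flow_deriv)
    then have X: "(?X has_vector_derivative - phase_field B (?X t)) (at t)"
      by (simp add: o_def)
    have "((\<lambda>t. (fst (?X t), - snd (?X t))) has_vector_derivative
        (fst (- phase_field B (?X t)), - snd (- phase_field B (?X t)))) (at t)"
      by (intro has_vector_derivative_Pair has_vector_derivative_minus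
          bounded_linear.has_vector_derivative[OF bounded_linear_fst X]
          bounded_linear.has_vector_derivative[OF bounded_linear_snd X])
    then show ?thesis by (simp add: phase_field_def)
  qed
  from flow_unique[of ?x B, OF this, of "- t"] show ?thesis by simp
qed

text \<open>Changing the sign of the \<open>i\<close>-th component maps solutions to solutions. If position and velocity
of that component vanish at one time, the reflected solution has the same data there, so by uniqueness it is the
same solution. This takes the place of a strong maximum principle: a nonnegative component that touches
zero has velocity zero at the contact and hence is identically zero.\<close>

lemma zero_component_stays_zero:
  assumes "position B a t0 $ i = 0" "velocity B a t0 $ i = 0"
  shows "position B a t $ i = 0"
proof -
  define flip :: "real ^ 'a \<Rightarrow> real ^ 'a" where "flip = (\<lambda>v. \<chi> j. if j = i then - v $ j else v $ j)"
  have flip_lin: "linear flip"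
    by (rule linearI) (auto simp: flip_def vec_eq_iff algebra_simps)
  then have flip_bl: "bounded_linear flip" by (rule linear_conv_bounded_linear[THEN iffD1])
  have force: "clamped_force B (flip u) = flip (clamped_force B u)" for u
  proof -
    have "(clamp1 (flip u $ j))\<^sup>2 = (clamp1 (u $ j))\<^sup>2" for j by (simp add: flip_def clamp1_minus)
    then show ?thesis
      by (auto simp: clamped_force_def vec_eq_iff sum_negf[symmetric] flip_def clamp1_minus)
  qed
  let ?x = "\<lambda>t. (flip (position B a (t0 + t)), flip (velocity B a (t0 + t)))"
  have "(?x has_vector_derivative phase_field B (?x t)) (at t)" for t
  proof -
    let ?X = "\<lambda>t. flow B (flow B a t0) t"
    have X: "(?X has_vector_derivative phase_field B (?X t)) (at t)" by (rule flow_deriv)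
    have "((\<lambda>t. (flip (fst (?X t)), flip (snd (?X t)))) has_vector_derivative
        (flip (fst (phase_field B (?X t))), flip (snd (phase_field B (?X t))))) (at t)"
      by (intro has_vector_derivative_Pair bounded_linear.has_vector_derivative[OF flip_bl]
          bounded_linear.has_vector_derivative[OF bounded_linear_fst X]
          bounded_linear.has_vector_derivative[OF bounded_linear_snd X])
    then show ?thesis
      by (simp add: phase_field_def force linear_neg[OF flip_lin] flow_add)
  qed
  from flow_unique[of ?x B, OF this, of "t - t0"]
  have "flow B (?x 0) (t - t0) = (flip (position B a t), flip (velocity B a t))" by simp
  moreover have "?x 0 = flow B a t0"
    using assms by (auto simp: flip_def prod_eq_iff vec_eq_iff)
  ultimately have "flow B a t = (flip (position B a t), flip (velocity B a t))"
    by (simp add: flow_add)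
  then have "position B a t $ i = flip (position B a t) $ i" by (metis fst_conv)
  then show ?thesis by (simp add: flip_def)
qed

definition quad_form :: "real ^ 'n ^ 'n \<Rightarrow> real ^ 'n \<Rightarrow> real" where
  "quad_form B c = (\<Sum>i\<in>UNIV. \<Sum>j\<in>UNIV. B $ i $ j * c $ i * c $ j)"

definition squares :: "real ^ 'n \<Rightarrow> real ^ 'n" where
  "squares u = (\<chi> i. (u $ i)\<^sup>2)"

definition energy :: "real ^ 'n ^ 'n \<Rightarrow> (real ^ 'n) \<times> (real ^ 'n) \<Rightarrow> real" where
  "energy B a = snd a \<bullet> snd a / 2 + quad_form B (squares (fst a)) / 4"

lemma continuous_on_energy: "continuous_on X (energy B)"
  unfolding energy_def quad_form_def squares_def by (auto intro!: continuous_intros)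

text \<open>Symmetry of \<open>B\<close> makes the cubic force the gradient of the potential; inside the unit ball the truncated force is
the cubic force.\<close>

lemma energy_derivative_zero:
  assumes sym: "transpose B = B" and le: "norm (position B a t) \<le> 1"
  shows "((\<lambda>t. energy B (flow B a t)) has_real_derivative 0) (at t)"
proof -
  have sym': "B $ i $ j = B $ j $ i" for i j
    using sym by (metis transpose_def vec_lambda_beta)
  let ?u = "\<lambda>t i. position B a t $ i" and ?w = "\<lambda>t i. velocity B a t $ i"
  have force: "clamped_force B (position B a t) $ i = (\<Sum>j\<in>UNIV. B $ i $ j * (?u t j)\<^sup>2 * ?u t i)" for i
  proof -
    have "\<bar>?u t j\<bar> \<le> 1" for j using component_le_norm_cart[of "position B a t" j] le by simp
    then show ?thesis by (simp add: clamped_force_def clamp1_eq)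
  qed
  have eq: "energy B (flow B a r) = (\<Sum>i\<in>UNIV. ?w r i * ?w r i) / 2
      + (\<Sum>i\<in>UNIV. \<Sum>j\<in>UNIV. B $ i $ j * (?u r i)\<^sup>2 * (?u r j)\<^sup>2) / 4" for r
    by (simp add: energy_def quad_form_def squares_def inner_vec_def)
  note dp = position_component_deriv[of B a _ t] and dv = velocity_component_deriv[of B a _ t]
  have kin: "((\<lambda>r. ?w r i * ?w r i) has_real_derivative - 2 * (clamped_force B (position B a t) $ i * ?w t i)) (at t)" for i
    using DERIV_mult[OF dv[of i] dv[of i]] by (simp add: algebra_simps)
  have sq: "((\<lambda>r. (?u r i)\<^sup>2) has_real_derivative 2 * ?u t i * ?w t i) (at t)" for i
    using DERIV_power[OF dp[of i], of 2] by (simp add: algebra_simps)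
  have pot: "((\<lambda>r. B $ i $ j * (?u r i)\<^sup>2 * (?u r j)\<^sup>2) has_real_derivative
      B $ i $ j * (2 * ?u t i * ?w t i) * (?u t j)\<^sup>2 + B $ i $ j * (?u t i)\<^sup>2 * (2 * ?u t j * ?w t j)) (at t)" for i j
    using DERIV_mult[OF DERIV_cmult[OF sq[of i], of "B $ i $ j"] sq[of j]] by (simp add: algebra_simps)
  define S where "S = (\<Sum>i\<in>UNIV. \<Sum>j\<in>UNIV. B $ i $ j * (2 * ?u t i * ?w t i) * (?u t j)\<^sup>2)"
  have S1: "(\<Sum>i\<in>UNIV. \<Sum>j\<in>UNIV. B $ i $ j * (?u t i)\<^sup>2 * (2 * ?u t j * ?w t j)) = S"
    unfolding S_def
  proof (subst sum.swap, intro sum.cong refl)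
    fix i j
    show "B $ j $ i * (?u t j)\<^sup>2 * (2 * ?u t i * ?w t i) = B $ i $ j * (2 * ?u t i * ?w t i) * (?u t j)\<^sup>2"
      by (subst sym'[of j i]) (simp only: ac_simps)
  qed
  have F: "- 2 * (clamped_force B (position B a t) $ i * ?w t i)
      = - (\<Sum>j\<in>UNIV. B $ i $ j * (2 * ?u t i * ?w t i) * (?u t j)\<^sup>2)" for i
    by (simp add: force sum_distrib_right sum_distrib_left ac_simps sum_negf)
  have S2: "(\<Sum>i\<in>UNIV. - 2 * (clamped_force B (position B a t) $ i * ?w t i)) = - S"
    unfolding S_def F sum_negf ..
  have "((\<lambda>r. energy B (flow B a r)) has_real_derivative
      (\<Sum>i\<in>UNIV. - 2 * (clamped_force B (position B a t) $ i * ?w t i)) / 2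
      + (\<Sum>i\<in>UNIV. \<Sum>j\<in>UNIV. B $ i $ j * (2 * ?u t i * ?w t i) * (?u t j)\<^sup>2
          + B $ i $ j * (?u t i)\<^sup>2 * (2 * ?u t j * ?w t j)) / 4) (at t)"
    unfolding eq
    by (intro DERIV_add DERIV_cdivide DERIV_sum kin pot)
  then show ?thesis
    unfolding sum.distrib S1 S2 S_def[symmetric] by simp
qed

lemma energy_conserved:
  assumes sym: "transpose B = B" and le: "\<And>t. t \<in> {0..T} \<Longrightarrow> norm (position B a t) \<le> 1"
    and t: "t \<in> {0..T}"
  shows "energy B (flow B a t) = energy B a"
proof -
  have "\<exists>c. \<forall>t\<in>{0..T}. energy B (flow B a t) = c"
    by (rule has_field_derivative_zero_constant)
      (simp, rule has_field_derivative_at_within, rule energy_derivative_zero[OF sym le])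
  then show ?thesis using t by (metis atLeastAtMost_iff flow_0 order.refl order.trans)
qed

section \<open>Trajectories leaving the positive orthant\<close>

text \<open>The ball condition is imposed up to the moment of exit, so that the whole path up to that moment is
governed by the original cubic force.\<close>

definition exits_orthant :: "real ^ 'n ^ 'n \<Rightarrow> (real ^ 'n) \<times> (real ^ 'n) \<Rightarrow> bool" where
  "exits_orthant B a \<longleftrightarrow>
     (\<exists>t\<ge>0. (\<exists>i. position B a t $ i < 0) \<and> (\<forall>r\<in>{0..t}. norm (position B a r) < 1))"

definition trapped :: "real ^ 'n ^ 'n \<Rightarrow> (real ^ 'n) \<times> (real ^ 'n) \<Rightarrow> bool" where
  "trapped B a \<longleftrightarrow> (\<forall>t. norm (position B a t) \<le> 1 \<and> (\<forall>i. 0 \<le> position B a t $ i))"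

definition positive_exactly_on :: "'n set \<Rightarrow> real ^ 'n \<Rightarrow> bool" where
  "positive_exactly_on S p \<longleftrightarrow> (\<forall>i. if i \<in> S then 0 < p $ i else p $ i = 0)"

lemma trapped_if_forward:
  assumes "\<And>t. 0 \<le> t \<Longrightarrow> norm (position B (p, 0) t) \<le> 1 \<and> (\<forall>i. 0 \<le> position B (p, 0) t $ i)"
  shows "trapped B (p, 0)"
  unfolding trapped_def
proof
  fix t
  have "position B (p, 0) t = position B (p, 0) \<bar>t\<bar>"
    using flow_even[of B p "- t"] by (cases "0 \<le> t") auto
  then show "norm (position B (p, 0) t) \<le> 1 \<and> (\<forall>i. 0 \<le> position B (p, 0) t $ i)"
    using assms[of "\<bar>t\<bar>"] by simp
qed

text \<open>Both conditions in the definition are strict and concern a compact time interval, so they survive a small change of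
the initial value.\<close>

lemma exits_orthant_open:
  assumes "exits_orthant B a"
  shows "\<exists>d>0. \<forall>b. dist b a < d \<longrightarrow> exits_orthant B b"
proof -
  obtain t i where t: "0 \<le> t" "position B a t $ i < 0" "\<And>r. r \<in> {0..t} \<Longrightarrow> norm (position B a r) < 1"
    using assms unfolding exits_orthant_def by blast
  have "\<exists>r\<in>{0..t}. \<forall>y\<in>{0..t}. norm (position B a y) \<le> norm (position B a r)"
    using t(1) by (intro continuous_attains_sup) (auto intro!: continuous_intros)
  then obtain r where r: "r \<in> {0..t}" "\<And>y. y \<in> {0..t} \<Longrightarrow> norm (position B a y) \<le> norm (position B a r)"
    by blast
  define m where "m = min (1 - norm (position B a r)) (- position B a t $ i)"
  have m: "0 < m" using t r by (auto simp: m_def)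
  define L where "L = exp (field_lipschitz_const B * t)"
  have L: "0 < L" by (simp add: L_def)
  have K0: "0 \<le> field_lipschitz_const B" by (rule lipschitz_on_nonneg[OF phase_field_lipschitz])
  show ?thesis
  proof (intro exI[of _ "m / L"] conjI allI impI)
    show "0 < m / L" using m L by simp
    fix b assume b: "dist b a < m / L"
    have close: "norm (position B b s - position B a s) < m" if s: "s \<in> {0..t}" for s
    proof -
      have "norm (position B b s - position B a s) \<le> dist (flow B b s) (flow B a s)"
        using norm_fst_le[of "fst (flow B b s - flow B a s)" "snd (flow B b s - flow B a s)"]
        unfolding prod.collapse by (simp add: dist_norm)
      also have "\<dots> \<le> exp (field_lipschitz_const B * \<bar>s\<bar>) * dist b a" by (rule flow_dist)
      also have "\<dots> \<le> L * dist b a"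
        unfolding L_def using s K0 by (intro mult_right_mono) (auto intro: mult_left_mono)
      also have "\<dots> < L * (m / L)" using b L by (rule mult_strict_left_mono)
      finally show ?thesis using L by simp
    qed
    show "exits_orthant B b"
      unfolding exits_orthant_def
    proof (intro exI[of _ t] conjI ballI)
      show "0 \<le> t" by fact
      have "position B b t $ i - position B a t $ i < m"
        using close[of t] t(1) component_le_norm_cart[of "position B b t - position B a t" i] by simp
      then show "\<exists>i. position B b t $ i < 0" by (intro exI[of _ i]) (simp add: m_def)
      fix s assume s: "s \<in> {0..t}"
      then show "norm (position B b s) < 1"
        using close[OF s] r(2)[OF s] norm_triangle_sub[of "position B b s" "position B a s"]
        by (simp add: m_def)
    qed
  qed
qed

lemma off_support_stays_zero:
  assumes "positive_exactly_on S p" "i \<notin> S"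
  shows "position B (p, 0) t $ i = 0"
  by (rule zero_component_stays_zero[of _ _ 0]) (use assms in \<open>auto simp: positive_exactly_on_def\<close>)

lemma first_boundary_contact:
  assumes p: "positive_exactly_on S p" and t: "0 \<le> t" and neg: "position B (p, 0) t $ i0 < 0"
  shows "\<exists>T\<in>{0..t}. (\<forall>s\<in>{0..T}. \<forall>i. 0 \<le> position B (p, 0) s $ i) \<and> (\<exists>i\<in>S. position B (p, 0) T $ i = 0)"
proof -
  let ?u = "\<lambda>s i. position B (p, 0) s $ i"
  have cont: "continuous_on X (\<lambda>s. ?u s i)" for X i by (intro continuous_intros)
  have i0: "i0 \<in> S" using off_support_stays_zero[OF p] neg by (metis less_irrefl)
  define Z where "Z = (\<Union>i\<in>S. {s \<in> {0..t}. ?u s i \<le> 0})"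
  have "closed Z" unfolding Z_def
  proof (intro closed_UN ballI)
    show "closed {s \<in> {0..t}. ?u s i \<le> 0}" for i
      by (intro continuous_on_closed_Collect_le cont continuous_on_const) simp
  qed simp
  then have "compact Z" unfolding Z_def
    by (intro bounded_subset[OF bounded_closed_interval] iffD2[OF compact_eq_bounded_closed] conjI) auto
  moreover have "t \<in> Z" using i0 t neg by (auto simp: Z_def intro: less_imp_le)
  ultimately obtain T where T: "T \<in> Z" "\<And>s. s \<in> Z \<Longrightarrow> T \<le> s"
    using compact_attains_inf[of Z] by blast
  have nonneg: "0 \<le> ?u s i" if s: "s \<in> {0..T}" for s i
  proof (cases "i \<in> S")
    case False
    then show ?thesis using off_support_stays_zero[OF p, of i B s] by simp
  next
    case True
    show ?thesis
    proof (rule ccontr)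
      assume "\<not> 0 \<le> ?u s i"
      then have lt: "?u s i < 0" by simp
      have p0: "0 < ?u 0 i" using p True by (auto simp: positive_exactly_on_def)
      then obtain r where r: "0 \<le> r" "r \<le> s" "?u r i = 0"
        using IVT2'[of "\<lambda>s. ?u s i" s 0 0, OF _ _ _ cont] lt s by auto
      have "r \<in> Z"
        using r s T(1) unfolding Z_def by (intro UN_I[OF True]) auto
      then have "r = s" using T(2)[of r] r s by auto
      then show False using r lt by simp
    qed
  qed
  obtain i where "i \<in> S" "?u T i \<le> 0" using T(1) by (auto simp: Z_def)
  moreover have "T \<in> {0..t}" using T(1) by (auto simp: Z_def)
  ultimately show ?thesis using nonneg
    by (intro bexI[of _ T] conjI ballI allI bexI[of _ i] antisym) auto
qed

text \<open>Only the \<open>k\<close>-th component \<open>y\<close> moves, by \<open>y'' = - B\<^sub>k\<^sub>k y\<^sup>3\<close> with a positive coefficient. As long as it is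
positive it is concave and starts with slope zero, so it decreases, reaches zero in finite time, and
crosses zero with negative velocity.\<close>

lemma axis_exits_orthant:
  fixes B :: "real ^ 'n ^ 'n"
  assumes B: "0 < B $ k $ k" and e: "0 < e" "e < 1"
  shows "exits_orthant B (axis k e, 0)"
proof -
  let ?a = "(axis k e, 0) :: (real ^ 'n) \<times> (real ^ 'n)"
  define y where "y = (\<lambda>t. position B ?a t $ k)"
  define z where "z = (\<lambda>t. velocity B ?a t $ k)"
  have supp: "positive_exactly_on {k} (axis k e)" using e by (auto simp: positive_exactly_on_def axis_def)
  have off: "position B ?a t $ i = 0" if "i \<noteq> k" for i t
    by (rule off_support_stays_zero[OF supp]) (use that in simp)
  have pos: "position B ?a t = axis k (y t)" for t
    using off by (auto simp: vec_eq_iff axis_def y_def)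
  have normy: "norm (position B ?a t) = \<bar>y t\<bar>" for t
    unfolding pos by (simp add: norm_eq_sqrt_inner inner_axis_axis)
  have dy: "(y has_real_derivative z t) (at t)" for t
    unfolding y_def z_def by (rule position_component_deriv)
  have force: "clamped_force B (position B ?a t) $ k = B $ k $ k * (clamp1 (y t))\<^sup>2 * clamp1 (y t)" for t
  proof -
    have "clamped_force B (position B ?a t) $ k
        = (\<Sum>j\<in>UNIV. if j = k then B $ k $ k * (clamp1 (y t))\<^sup>2 * clamp1 (y t) else 0)"
      unfolding clamped_force_def vec_lambda_beta
    proof (intro sum.cong refl)
      fix j
      show "B $ k $ j * (clamp1 (position B ?a t $ j))\<^sup>2 * clamp1 (position B ?a t $ k)
          = (if j = k then B $ k $ k * (clamp1 (y t))\<^sup>2 * clamp1 (y t) else 0)"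
        by (cases "j = k") (simp_all add: y_def off clamp1_def)
    qed
    then show ?thesis by simp
  qed
  have dz: "(z has_real_derivative - (B $ k $ k * (clamp1 (y t))\<^sup>2 * clamp1 (y t))) (at t)" for t
    using velocity_component_deriv[of B ?a k t] unfolding force z_def by simp
  have y0: "y 0 = e" "z 0 = 0" by (simp_all add: y_def z_def)
  have conty: "continuous_on X y" for X
    unfolding y_def by (intro continuous_intros)
  have not_stay: "\<exists>t\<ge>0. y t \<le> 0 \<or> 1 \<le> y t"
  proof (rule ccontr)
    assume "\<not> ?thesis"
    then have in01: "0 < y t" "y t < 1" if "0 \<le> t" for t using that by force+
    have zneg: "- (B $ k $ k * (clamp1 (y t))\<^sup>2 * clamp1 (y t)) < 0" if "0 \<le> t" for t
      using in01[OF that] B by (simp add: clamp1_eq)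
    have "z 1 < z 0"
    proof (rule DERIV_neg_imp_decreasing[of 0 1 z])
      fix t :: real assume "0 \<le> t"
      then show "\<exists>D. (z has_real_derivative D) (at t) \<and> D < 0" using dz zneg by blast
    qed simp
    then have z1: "z 1 < 0" by (simp add: y0)
    have zle: "z t \<le> z 1" if "1 \<le> t" for t
      by (rule DERIV_nonpos_imp_nonincreasing[OF that])
        (use dz zneg in \<open>auto intro!: exI less_imp_le\<close>)
    define t where "t = 1 + 2 / (- z 1)"
    have t: "1 \<le> t" using z1 by (simp add: t_def divide_nonpos_neg)
    have "y t - z 1 * t \<le> y 1 - z 1 * 1"
    proof (rule DERIV_nonpos_imp_nonincreasing[OF t])
      fix s :: real assume "1 \<le> s"
      then have "((\<lambda>t. y t - z 1 * t) has_real_derivative z s - z 1) (at s)" "z s - z 1 \<le> 0"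
        using zle[of s] by (auto intro!: derivative_eq_intros dy)
      then show "\<exists>D. ((\<lambda>t. y t - z 1 * t) has_real_derivative D) (at s) \<and> D \<le> 0" by blast
    qed
    moreover have "z 1 * t = z 1 - 2" using z1 by (simp add: t_def field_simps)
    ultimately have "y t < 0" using in01[of 1] by simp
    then show False using in01[of t] t by simp
  qed
  then obtain t where t: "0 \<le> t" "y t \<le> 0 \<or> 1 \<le> y t" by blast
  \<comment> \<open>The component first leaves the open interval from 0 to 1 at the minimum \<open>T\<close> of this set; monotonicity shows that it does so at 0.\<close>
  define Z where "Z = {s \<in> {0..t}. y s \<le> 0} \<union> {s \<in> {0..t}. 1 \<le> y s}"
  have "closed Z" unfolding Z_def
    by (intro closed_Un continuous_on_closed_Collect_le continuous_intros conty closed_atLeastAtMost)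
  then have "compact Z" unfolding Z_def
    by (intro bounded_subset[OF bounded_closed_interval] iffD2[OF compact_eq_bounded_closed] conjI) auto
  moreover have "t \<in> Z" using t by (auto simp: Z_def)
  ultimately obtain T where T: "T \<in> Z" "\<And>s. s \<in> Z \<Longrightarrow> T \<le> s"
    using compact_attains_inf[of Z] by blast
  have T0: "0 \<le> T" "T \<le> t" using T(1) by (auto simp: Z_def)
  have in01: "0 < y s" "y s < 1" if "0 \<le> s" "s < T" for s
    using T(2)[of s] T0 that by (fastforce simp: Z_def)+
  have "T \<noteq> 0" using T(1) e by (auto simp: Z_def y0)
  with T0 have Tpos: "0 < T" by simp
  have "closure {0..<T} \<subseteq> {s. 0 \<le> y s \<and> y s \<le> 1}"
    using in01 by (intro closure_minimal closed_Collect_conj closed_Collect_le conty continuous_on_const)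
      (auto intro: less_imp_le)
  moreover have "T \<in> closure {0..<T}" using Tpos by simp
  ultimately have yT: "0 \<le> y T" "y T \<le> 1" by auto
  have yle: "0 \<le> y s \<and> y s \<le> 1" if "s \<in> {0..T}" for s
    using in01[of s] yT that by (cases "s = T") auto
  have zle: "z s \<le> 0" if "s \<in> {0..T}" for s
  proof -
    have "z s \<le> z 0"
    proof (rule DERIV_nonpos_imp_nonincreasing[of 0 s z])
      fix r :: real assume "0 \<le> r" "r \<le> s"
      then have "0 \<le> y r \<and> y r \<le> 1" using yle that by auto
      then have "- (B $ k $ k * (clamp1 (y r))\<^sup>2 * clamp1 (y r)) \<le> 0"
        using B by (simp add: clamp1_eq)
      with dz show "\<exists>D. (z has_real_derivative D) (at r) \<and> D \<le> 0" by blast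
    qed (use that in auto)
    then show ?thesis by (simp add: y0)
  qed
  have ye: "y s \<le> e" if "s \<in> {0..T}" for s
  proof -
    have "y s \<le> y 0"
    proof (rule DERIV_nonpos_imp_nonincreasing[of 0 s y])
      fix r :: real assume "0 \<le> r" "r \<le> s"
      then show "\<exists>D. (y has_real_derivative D) (at r) \<and> D \<le> 0" using dy zle[of r] that by auto
    qed (use that in auto)
    then show ?thesis by (simp add: y0)
  qed
  have yT0: "y T = 0" using T(1) yT ye[of T] T0 e by (auto simp: Z_def)
  have "z T \<noteq> 0"
  proof
    assume "z T = 0"
    then have "position B ?a 0 $ k = 0"
      using zero_component_stays_zero[of B ?a T k 0] yT0 by (simp add: y_def z_def)
    then show False using e by (simp add: axis_def)
  qed
  then have "z T < 0" using zle[of T] T0 by simp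
  from DERIV_neg_dec_right[OF dy this] obtain d where d: "0 < d" "\<And>h. 0 < h \<Longrightarrow> h < d \<Longrightarrow> y (T + h) < y T"
    by blast
  have "isCont y T" using conty[of UNIV] by (simp add: continuous_on_eq_continuous_at)
  then obtain d' where d': "0 < d'" "\<And>s. dist s T < d' \<Longrightarrow> dist (y s) (y T) < 1"
    unfolding continuous_at_eps_delta by (metis zero_less_one)
  define h where "h = min d d' / 2"
  have h: "0 < h" "h < d" "h < d'" using d d' by (auto simp: h_def)
  show ?thesis
    unfolding exits_orthant_def
  proof (intro exI[of _ "T + h"] conjI ballI)
    show "0 \<le> T + h" using T0 h by simp
    have "y (T + h) < 0" using d(2)[OF h(1,2)] yT0 by simp
    then show "\<exists>i. position B ?a (T + h) $ i < 0" unfolding y_def by blast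
    fix r assume r: "r \<in> {0..T + h}"
    show "norm (position B ?a r) < 1"
    proof (cases "r \<le> T")
      case True
      then show ?thesis using yle[of r] ye[of r] r e by (simp add: normy)
    next
      case False
      then show ?thesis using d'(2)[of r] r h by (simp add: normy yT0 dist_real_def)
    qed
  qed
qed

text \<open>This is what minimality of the support \<open>S\<close> of a vector with nonpositive form value provides: the form is
positive on all nonzero nonnegative vectors whose support is strictly contained in \<open>S\<close>.\<close>

definition positive_on_proper_faces :: "real ^ 'n ^ 'n \<Rightarrow> 'n set \<Rightarrow> bool" where
  "positive_on_proper_faces B S \<longleftrightarrow>
     (\<forall>d. (\<forall>i. 0 \<le> d $ i) \<and> d \<noteq> 0 \<and> {i. d $ i \<noteq> 0} \<subset> S \<longrightarrow> 0 < quad_form B d)"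

text \<open>On the boundary of the orthant over \<open>S\<close> the potential is positive except at the origin, so energy at most zero
forces position and velocity to vanish.\<close>

lemma boundary_low_energy_zero:
  assumes S: "positive_on_proper_faces B S" and nonneg: "\<And>i. 0 \<le> u $ i"
    and off: "\<And>i. i \<notin> S \<Longrightarrow> u $ i = 0" and k: "k \<in> S" "u $ k = 0"
    and E: "energy B (u, w) \<le> 0"
  shows "(u, w) = 0"
proof -
  have u: "u = 0"
  proof (rule ccontr)
    assume "u \<noteq> 0"
    then obtain i where "u $ i \<noteq> 0" by (auto simp: vec_eq_iff)
    then have "squares u $ i \<noteq> 0" by (simp add: squares_def)
    then have "squares u \<noteq> 0" by auto
    moreover have "{i. squares u $ i \<noteq> 0} \<subset> S"
      using off k by (auto simp: squares_def)
    moreover have "\<forall>i. 0 \<le> squares u $ i" by (simp add: squares_def)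
    ultimately have "0 < quad_form B (squares u)" using S unfolding positive_on_proper_faces_def by blast
    moreover have "energy B (u, w) = w \<bullet> w / 2 + quad_form B (squares u) / 4"
      by (simp add: energy_def)
    ultimately show False using E inner_ge_zero[of w] by linarith
  qed
  then have "w \<bullet> w \<le> 0" using E by (simp add: energy_def quad_form_def squares_def)
  then have "w = 0" by (metis inner_ge_zero inner_eq_zero_iff order_antisym)
  with u show ?thesis by (simp add: zero_prod_def)
qed

text \<open>At the first contact with the boundary a particle of energy at most zero would be at rest at the
origin, hence would have been there from the beginning.\<close>

lemma low_energy_does_not_exit:
  assumes sym: "transpose B = B" and S: "positive_on_proper_faces B S" and q: "positive_exactly_on S q"
    and E: "quad_form B (squares q) \<le> 0"
  shows "\<not> exits_orthant B (q, 0)"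
proof
  assume "exits_orthant B (q, 0)"
  then obtain t i where t: "0 \<le> t" "position B (q, 0) t $ i < 0"
    and lt: "\<And>r. r \<in> {0..t} \<Longrightarrow> norm (position B (q, 0) r) < 1"
    unfolding exits_orthant_def by blast
  from first_boundary_contact[OF q t] obtain T k where T: "T \<in> {0..t}"
    and nonneg: "\<And>s i. s \<in> {0..T} \<Longrightarrow> 0 \<le> position B (q, 0) s $ i"
    and k: "k \<in> S" "position B (q, 0) T $ k = 0" by blast
  have "energy B (flow B (q, 0) T) = energy B (q, 0)"
  proof (rule energy_conserved[OF sym, of T])
    show "norm (position B (q, 0) r) \<le> 1" if "r \<in> {0..T}" for r
      using lt[of r] that T by simp
  qed (use T in simp)
  moreover have "energy B (q, 0) \<le> 0" using E by (simp add: energy_def)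
  ultimately have "energy B (position B (q, 0) T, velocity B (q, 0) T) \<le> 0" by simp
  then have "(position B (q, 0) T, velocity B (q, 0) T) = 0"
  proof (rule boundary_low_energy_zero[OF S _ _ k, rotated 2])
    show "0 \<le> position B (q, 0) T $ i" for i using nonneg[of T i] T by simp
    show "position B (q, 0) T $ i = 0" if "i \<notin> S" for i by (rule off_support_stays_zero[OF q that])
  qed
  then have "flow B (q, 0) T = 0" by simp
  then have "position B (q, 0) 0 $ k = 0"
    using zero_component_stays_zero[of B "(q, 0)" T k 0] by simp
  moreover have "0 < q $ k" using q k(1) unfolding positive_exactly_on_def by presburger
  ultimately show False by simp
qed

text \<open>Starting points whose trajectory exits form a relatively open part of the path containing its beginning but not its
end. Let \<open>s\<close> be the first parameter that does not exit, and approach it by parameters that do. If the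
times of first contact with the boundary were unbounded, the trajectory of \<open>s\<close> would be trapped;
so they converge along a subsequence, and in the limit the trajectory of \<open>s\<close> touches the boundary at a time
\<open>T'\<close>. Had it stayed in the open unit ball until then, it could not cross the boundary
right after \<open>T'\<close> either, so the touching component would have a minimum there, hence vanish
identically. Therefore it reaches norm 1 before the contact.\<close>

lemma critical_trajectory:
  fixes p :: "real \<Rightarrow> real ^ 'n"
  assumes cont: "continuous_on {0..1} p"
    and pos: "\<And>s. s \<in> {0<..1} \<Longrightarrow> positive_exactly_on S (p s)"
    and ex0: "exits_orthant B (p 0, 0)" and ex1: "\<not> exits_orthant B (p 1, 0)"
    and untrapped: "\<And>s. s \<in> {0..1} \<Longrightarrow> \<not> trapped B (p s, 0)"
  shows "\<exists>s\<in>{0<..1}. \<exists>T. \<exists>r\<in>{0..T}. norm (position B (p s, 0) r) = 1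
      \<and> (\<forall>t\<in>{0..T}. norm (position B (p s, 0) t) \<le> 1 \<and> (\<forall>i. 0 \<le> position B (p s, 0) t $ i))
      \<and> (\<exists>i\<in>S. position B (p s, 0) T $ i = 0)"
proof -
  define N where "N = {s \<in> {0..1}. \<not> exits_orthant B (p s, 0)}"
  define D where "D = {u :: real ^ 'n. norm u \<le> 1 \<and> (\<forall>i. 0 \<le> u $ i)}"
  have closedD: "closed D"
    unfolding D_def by (intro closed_Collect_conj closed_Collect_all closed_Collect_le continuous_intros)
  have closedN: "closed N"
    unfolding closed_sequential_limits
  proof (intro allI impI, elim conjE)
    fix x l assume x: "\<forall>n. x n \<in> N" "x \<longlonglongrightarrow> l"
    have l: "l \<in> {0..1}"
      using closed_sequentially[OF closed_atLeastAtMost, of x 0 1 l] x by (auto simp: N_def)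
    have "\<not> exits_orthant B (p l, 0)"
    proof
      assume "exits_orthant B (p l, 0)"
      then obtain d where d: "0 < d" "\<And>b. dist b (p l, 0) < d \<Longrightarrow> exits_orthant B b"
        using exits_orthant_open by blast
      have "(\<lambda>n. p (x n)) \<longlonglongrightarrow> p l"
        by (rule continuous_on_tendsto_compose[OF cont x(2) l]) (use x(1) in \<open>auto simp: N_def\<close>)
      then obtain n where "dist (p (x n)) (p l) < d"
        using d(1) unfolding lim_sequentially by blast
      then have "exits_orthant B (p (x n), 0)" by (intro d(2)) (simp add: dist_Pair_Pair)
      then show False using x(1) by (auto simp: N_def)
    qed
    then show "l \<in> N" using l by (simp add: N_def)
  qed
  then have "compact N" unfolding N_def
    by (intro bounded_subset[OF bounded_closed_interval] iffD2[OF compact_eq_bounded_closed] conjI) auto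
  moreover have "1 \<in> N" using ex1 by (simp add: N_def)
  ultimately obtain s where s: "s \<in> N" "\<And>r. r \<in> N \<Longrightarrow> s \<le> r"
    using compact_attains_inf[of N] by blast
  have s01: "s \<in> {0<..1}" using s(1) ex0 by (cases "s = 0") (auto simp: N_def)
  let ?a = "(p s, 0)"
  have nexit: "\<not> exits_orthant B ?a" using s(1) by (simp add: N_def)
  \<comment> \<open>A time at which the trajectory is outside of the closed set \<open>D\<close> bounds the contact times of nearby trajectories.\<close>
  have "\<exists>t\<ge>0. position B ?a t \<notin> D"
  proof (rule ccontr)
    assume "\<not> ?thesis"
    then have "trapped B ?a" by (intro trapped_if_forward) (simp add: D_def)
    then show False using untrapped[of s] s01 by simp
  qed
  then obtain t0 where t0: "0 \<le> t0" "position B ?a t0 \<notin> D" by blast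
  define x where "x = (\<lambda>k. s * (1 - 1 / real (k + 2)))"
  have x01: "x k \<in> {0<..<s}" for k
    using s01 by (auto simp: x_def field_simps add_pos_nonneg)
  have x01': "x k \<in> {0<..1}" for k using x01[of k] s01 by auto
  have "(\<lambda>k. s * (1 - 1 / real (k + 2))) \<longlonglongrightarrow> s * (1 - 0)"
    by (intro tendsto_intros LIMSEQ_ignore_initial_segment[OF lim_1_over_n])
  then have xs: "x \<longlonglongrightarrow> s" by (simp add: x_def)
  have x_ev: "\<forall>\<^sub>F k in sequentially. x k \<in> {0..1}"
  proof (intro always_eventually allI)
    show "x k \<in> {0..1}" for k using x01'[of k] by simp
  qed
  have px: "(\<lambda>k. p (x k)) \<longlonglongrightarrow> p s"
    by (rule continuous_on_tendsto_compose[OF cont xs _ x_ev]) (use s01 in simp)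
  have ax: "(\<lambda>k. (p (x k), 0)) \<longlonglongrightarrow> ?a" by (intro tendsto_intros px)
  have "\<exists>T. 0 \<le> T \<and> (\<forall>t\<in>{0..T}. position B (p (x k), 0) t \<in> D) \<and> (\<exists>i\<in>S. position B (p (x k), 0) T $ i = 0)" for k
  proof -
    have "x k \<notin> N" using s(2)[of "x k"] x01[of k] by auto
    then have "exits_orthant B (p (x k), 0)" using x01'[of k] by (auto simp: N_def)
    then obtain t i where t: "0 \<le> t" "position B (p (x k), 0) t $ i < 0"
      and lt: "\<And>r. r \<in> {0..t} \<Longrightarrow> norm (position B (p (x k), 0) r) < 1"
      unfolding exits_orthant_def by blast
    from first_boundary_contact[OF pos[OF x01'] t] obtain T where T: "T \<in> {0..t}"
      "\<And>s i. s \<in> {0..T} \<Longrightarrow> 0 \<le> position B (p (x k), 0) s $ i"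
      "\<exists>i\<in>S. position B (p (x k), 0) T $ i = 0" by blast
    have "position B (p (x k), 0) r \<in> D" if "r \<in> {0..T}" for r
      using T(2)[OF that] lt[of r] T(1) that by (simp add: D_def)
    then show ?thesis using T by (intro exI[of _ T]) simp
  qed
  then obtain T where T: "\<And>k. 0 \<le> T k" "\<And>k t. t \<in> {0..T k} \<Longrightarrow> position B (p (x k), 0) t \<in> D"
    "\<And>k. \<exists>i\<in>S. position B (p (x k), 0) (T k) $ i = 0"
    by metis
  have "\<forall>\<^sub>F k in sequentially. position B (p (x k), 0) t0 \<in> - D"
    by (rule topological_tendstoD[OF tendsto_fst[OF flow_tendsto[OF ax tendsto_const]]])
      (use closedD t0 in auto)
  then have "\<forall>\<^sub>F k in sequentially. T k < t0"
  proof eventually_elim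
    case (elim k)
    then show ?case using T(2)[of t0 k] t0(1) by (cases "T k < t0") simp_all
  qed
  then obtain n0 where n0: "\<And>k. n0 \<le> k \<Longrightarrow> T k < t0" unfolding eventually_sequentially by blast
  have "\<forall>k. T (k + n0) \<in> {0..t0}" using n0 T(1) by (auto intro: less_imp_le)
  then obtain T' \<rho> where T': "T' \<in> {0..t0}" "strict_mono \<rho>" "((\<lambda>k. T (k + n0)) \<circ> \<rho>) \<longlonglongrightarrow> T'"
    using compact_Icc[of 0 t0] unfolding compact_def by metis
  define \<kappa> where "\<kappa> = (\<lambda>k. \<rho> k + n0)"
  have \<kappa>: "strict_mono \<kappa>" using T'(2) by (auto simp: strict_mono_def \<kappa>_def)
  have Tlim: "(\<lambda>k. T (\<kappa> k)) \<longlonglongrightarrow> T'" using T'(3) by (simp add: o_def \<kappa>_def)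
  have a\<kappa>: "(\<lambda>k. (p (x (\<kappa> k)), 0)) \<longlonglongrightarrow> ?a"
    using LIMSEQ_subseq_LIMSEQ[OF ax \<kappa>] by (simp add: o_def)
  have inD: "position B ?a t \<in> D" if t: "t \<in> {0..T'}" for t
  proof (rule closed_sequentially[OF closedD])
    show "position B (p (x (\<kappa> k)), 0) (min t (T (\<kappa> k))) \<in> D" for k
      using T(1)[of "\<kappa> k"] t by (intro T(2)) auto
    have "(\<lambda>k. min t (T (\<kappa> k))) \<longlonglongrightarrow> min t T'" by (intro tendsto_intros Tlim)
    then show "(\<lambda>k. position B (p (x (\<kappa> k)), 0) (min t (T (\<kappa> k)))) \<longlonglongrightarrow> position B ?a t"
      using t by (intro tendsto_fst flow_tendsto a\<kappa>) (simp add: min_absorb1)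
  qed
  define Z where "Z = (\<Union>i\<in>S. {u :: real ^ 'n. u $ i = 0})"
  have "closed Z" unfolding Z_def
    by (intro closed_UN ballI closed_Collect_eq continuous_intros) simp
  then have "position B ?a T' \<in> Z"
  proof (rule closed_sequentially)
    show "position B (p (x (\<kappa> k)), 0) (T (\<kappa> k)) \<in> Z" for k
      using T(3)[of "\<kappa> k"] by (auto simp: Z_def)
    show "(\<lambda>k. position B (p (x (\<kappa> k)), 0) (T (\<kappa> k))) \<longlonglongrightarrow> position B ?a T'"
      by (intro tendsto_fst flow_tendsto a\<kappa> Tlim)
  qed
  then obtain i where i: "i \<in> S" "position B ?a T' $ i = 0" by (auto simp: Z_def)
  have p0: "0 < p s $ i" using pos[OF s01] i by (auto simp: positive_exactly_on_def)
  have "\<exists>r\<in>{0..T'}. norm (position B ?a r) = 1"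
  proof (rule ccontr)
    assume no: "\<not> ?thesis"
    have lt: "norm (position B ?a r) < 1" if "r \<in> {0..T'}" for r
    proof -
      have "norm (position B ?a r) \<le> 1" using inD[OF that] by (simp add: D_def)
      moreover have "norm (position B ?a r) \<noteq> 1" using no that by blast
      ultimately show ?thesis by simp
    qed
    have "continuous_on UNIV (\<lambda>t. norm (position B ?a t))" by (intro continuous_intros)
    then have "isCont (\<lambda>t. norm (position B ?a t)) T'" by (simp add: continuous_on_eq_continuous_at)
    moreover have "0 < 1 - norm (position B ?a T')" using lt[of T'] T'(1) by simp
    ultimately obtain d where d: "0 < d"
      "\<And>t. dist t T' < d \<Longrightarrow> dist (norm (position B ?a t)) (norm (position B ?a T')) < 1 - norm (position B ?a T')"
      unfolding continuous_at_eps_delta by blast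
    have near: "norm (position B ?a t) < 1" if "dist t T' < d" for t
      using d(2)[OF that] by (simp add: dist_real_def abs_less_iff)
    have T'pos: "0 < T'" using i p0 T'(1) by (cases "T' = 0") auto
    have nonneg: "0 \<le> position B ?a t $ i" if t: "\<bar>T' - t\<bar> < min d T'" for t
    proof (rule ccontr)
      assume neg: "\<not> ?thesis"
      have "exits_orthant B ?a"
        unfolding exits_orthant_def
      proof (intro exI[of _ t] conjI ballI)
        show "0 \<le> t" using t by linarith
        show "\<exists>i. position B ?a t $ i < 0" using neg by (intro exI[of _ i]) simp
        fix r assume r: "r \<in> {0..t}"
        show "norm (position B ?a r) < 1"
          using lt[of r] near[of r] r t by (cases "r \<le> T'") (simp_all add: dist_real_def)
      qed
      then show False using nexit by simp
    qed
    have "velocity B ?a T' $ i = 0"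
      by (rule DERIV_local_min[OF position_component_deriv, of "min d T'"])
        (use d T'pos nonneg i in auto)
    then have "position B ?a 0 $ i = 0" by (rule zero_component_stays_zero[OF i(2)])
    then show False using p0 by simp
  qed
  then show ?thesis using s01 inD i unfolding D_def by blast
qed

section \<open>Solutions for matrices that are not strictly copositive\<close>

lemma energy_sublevel_compact:
  "compact {a. norm (fst a) \<le> 1 \<and> energy B a \<le> M}"
proof -
  let ?C = "{a. norm (fst a) \<le> 1 \<and> energy B a \<le> M}"
  define Q where "Q = (\<Sum>i\<in>UNIV. \<Sum>j\<in>UNIV. \<bar>B $ i $ j\<bar>)"
  have "norm a \<le> 1 + sqrt (2 * M + Q / 2)" if a: "a \<in> ?C" for a
  proof -
    have sq: "\<bar>squares (fst a) $ i\<bar> \<le> 1" for i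
      using component_le_norm_cart[of "fst a" i] a by (simp add: squares_def abs_square_le_1)
    have "\<bar>quad_form B (squares (fst a))\<bar> \<le> Q"
      unfolding quad_form_def Q_def
    proof (rule order_trans[OF sum_abs sum_mono], rule order_trans[OF sum_abs sum_mono])
      fix i j
      have "\<bar>B $ i $ j * squares (fst a) $ i * squares (fst a) $ j\<bar> \<le> \<bar>B $ i $ j\<bar> * 1 * 1"
        unfolding abs_mult by (intro mult_mono sq) auto
      then show "\<bar>B $ i $ j * squares (fst a) $ i * squares (fst a) $ j\<bar> \<le> \<bar>B $ i $ j\<bar>" by simp
    qed
    then have "(norm (snd a))\<^sup>2 \<le> 2 * M + Q / 2"
      using a unfolding power2_norm_eq_inner energy_def mem_Collect_eq by linarith
    then have "norm (snd a) \<le> sqrt (2 * M + Q / 2)" by (rule real_le_rsqrt)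
    moreover have "norm a \<le> norm (fst a) + norm (snd a)"
      using norm_Pair_le[of "fst a" "snd a"] by simp
    ultimately show ?thesis using a by simp
  qed
  then have "bounded ?C" unfolding bounded_iff by blast
  moreover have "closed ?C"
    by (intro closed_Collect_conj closed_Collect_le continuous_intros continuous_on_energy)
  ultimately show ?thesis by (simp add: compact_eq_bounded_closed)
qed

text \<open>Applied backwards in time, this bounds from below the time a trajectory needs to move from near the
equilibrium to a given distance from it.\<close>

lemma norm_flow_le: "norm (flow B a t) \<le> exp (field_lipschitz_const B * \<bar>t\<bar>) * norm a"
  using flow_dist[of B a t "(0, 0)"] unfolding flow_zero unfolding zero_prod_def[symmetric] by simp

text \<open>The blow-up argument: critical trajectories for starting points that shrink to the origin, recentred at the
time when they have norm 1, converge to a trapped trajectory of energy zero.\<close>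

lemma exists_trapped:
  fixes B :: "real ^ 'n ^ 'n"
  assumes sym: "transpose B = B" and S: "positive_on_proper_faces B S" and q: "positive_exactly_on S q"
    and E: "quad_form B (squares q) \<le> 0" and k: "k \<in> S" "0 < B $ k $ k"
  shows "\<exists>a. fst a \<noteq> 0 \<and> trapped B a"
proof (rule ccontr)
  assume none: "\<not> ?thesis"
  define e where "e = (\<lambda>n. 1 / real (n + 2))"
  have e: "0 < e n" "e n < 1" for n by (auto simp: e_def)
  have elim: "e \<longlonglongrightarrow> 0" unfolding e_def by (rule LIMSEQ_ignore_initial_segment[OF lim_1_over_n])
  define p where "p = (\<lambda>n s. e n *\<^sub>R ((1 - s) *\<^sub>R axis k 1 + s *\<^sub>R q))"
  have qk: "0 < q $ k" using q k by (auto simp: positive_exactly_on_def)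
  have pk: "0 < p n s $ k" if "s \<in> {0..1}" for n s
  proof -
    have "0 < (1 - s) + s * q $ k"
      using that qk by (cases "s = 1") (auto intro: add_pos_nonneg)
    then show ?thesis using e(1)[of n] by (simp add: p_def axis_def)
  qed
  have pos: "positive_exactly_on S (p n s)" if s: "s \<in> {0<..1}" for n s
    unfolding positive_exactly_on_def
  proof
    fix i
    show "if i \<in> S then 0 < p n s $ i else p n s $ i = 0"
    proof (cases "i \<in> S")
      case True
      then have "0 < q $ i" using q by (auto simp: positive_exactly_on_def)
      then have "0 < (1 - s) * axis k 1 $ i + s * q $ i"
        using s by (intro add_nonneg_pos mult_nonneg_nonneg mult_pos_pos) (auto simp: axis_def)
      then show ?thesis using True e(1)[of n] by (simp add: p_def)
    next
      case False
      then show ?thesis using q k by (auto simp: positive_exactly_on_def p_def axis_def)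
    qed
  qed
  have "\<exists>s\<in>{0<..1}. \<exists>T. \<exists>r\<in>{0..T}. norm (position B (p n s, 0) r) = 1
      \<and> (\<forall>t\<in>{0..T}. norm (position B (p n s, 0) t) \<le> 1 \<and> (\<forall>i. 0 \<le> position B (p n s, 0) t $ i))
      \<and> (\<exists>i\<in>S. position B (p n s, 0) T $ i = 0)" for n
  proof (rule critical_trajectory[OF _ pos])
    show "continuous_on {0..1} (p n)" unfolding p_def by (intro continuous_intros)
    have "p n 0 = axis k (e n)" by (auto simp: p_def axis_def vec_eq_iff)
    then show "exits_orthant B (p n 0, 0)" using axis_exits_orthant[OF k(2) e] by simp
    have "squares (p n 1) = (e n)\<^sup>2 *\<^sub>R squares q"
      by (simp add: squares_def p_def vec_eq_iff power_mult_distrib)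
    then have "quad_form B (squares (p n 1)) = (e n) ^ 4 * quad_form B (squares q)"
      by (simp add: quad_form_def sum_distrib_left power4_eq_xxxx power2_eq_square ac_simps)
    then have "quad_form B (squares (p n 1)) \<le> 0"
      using E e(1)[of n] by (simp add: mult_nonneg_nonpos)
    then show "\<not> exits_orthant B (p n 1, 0)"
      by (intro low_energy_does_not_exit[OF sym S pos]) auto
    show "\<not> trapped B (p n s, 0)" if "s \<in> {0..1}" for s
    proof -
      have "p n s \<noteq> 0" using pk[OF that, of n] by auto
      then have "fst (p n s, 0 :: real ^ 'n) \<noteq> 0" by simp
      then show ?thesis using none by blast
    qed
  qed
  then obtain s T r where s: "\<And>n. s n \<in> {0<..1}" and r: "\<And>n. r n \<in> {0..T n}"
    and norm1: "\<And>n. norm (position B (p n (s n), 0) (r n)) = 1"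
    and stay: "\<And>n t. t \<in> {0..T n} \<Longrightarrow> norm (position B (p n (s n), 0) t) \<le> 1 \<and> (\<forall>i. 0 \<le> position B (p n (s n), 0) t $ i)"
    and touch: "\<And>n. \<exists>i\<in>S. position B (p n (s n), 0) (T n) $ i = 0"
    by metis
  define a where "a = (\<lambda>n. (p n (s n), 0 :: real ^ 'n))"
  have "norm (a n) \<le> e n * (1 + norm q)" for n
  proof -
    have "norm ((1 - s n) *\<^sub>R axis k 1 + s n *\<^sub>R q) \<le> (1 - s n) * 1 + s n * norm q"
      using s[of n] by (intro order_trans[OF norm_triangle_ineq]) simp
    also have "\<dots> \<le> 1 * 1 + 1 * norm q"
      using s[of n] by (intro add_mono mult_right_mono) auto
    finally show ?thesis
      using e(1)[of n] by (simp add: a_def p_def norm_Pair mult_left_mono)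
  qed
  moreover have "(\<lambda>n. e n * (1 + norm q)) \<longlonglongrightarrow> 0"
    using tendsto_mult_left_zero[OF elim] .
  ultimately have alim: "a \<longlonglongrightarrow> 0"
    by (intro Lim_null_comparison[of a]) (simp_all add: always_eventually)
  have contE: "isCont (energy B) x" for x
    by (rule continuous_on_interior[OF continuous_on_energy[of UNIV]]) simp
  have "(\<lambda>n. energy B (a n)) \<longlonglongrightarrow> energy B 0" by (rule isCont_tendsto_compose[OF contE alim])
  then have Elim: "(\<lambda>n. energy B (a n)) \<longlonglongrightarrow> 0"
    by (simp add: energy_def quad_form_def squares_def)
  then obtain M where M: "\<And>n. energy B (a n) \<le> M"
  proof -
    have "Bseq (\<lambda>n. energy B (a n))" using Elim convergentI convergent_imp_Bseq by blast
    then obtain K where "\<forall>n. norm (energy B (a n)) \<le> K" by (rule BseqE)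
    then have "energy B (a n) \<le> K" for n using abs_le_D1 by (metis real_norm_def)
    then show thesis by (rule that)
  qed
  define m where "m = (\<lambda>n. flow B (a n) (r n))"
  define b where "b = (\<lambda>n. flow B (a n) (T n))"
  have EC: "energy B (flow B (a n) t) = energy B (a n)" if "t \<in> {0..T n}" for n t
    using stay that unfolding a_def by (intro energy_conserved[OF sym, of "T n"]) auto
  have T: "T n \<in> {0..T n}" for n using r[of n] by simp
  \<comment> \<open>The recentred points \<open>m n\<close> and the contact points \<open>b n\<close> remain in a compact set, since the energy controls the velocity.\<close>
  let ?C = "{x. norm (fst x) \<le> 1 \<and> energy B x \<le> M}"
  have "(m n, b n) \<in> ?C \<times> ?C" for n
    unfolding m_def b_def using EC[OF r] EC[OF T] M[of n] stay[OF r] stay[OF T] by (simp add: a_def)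
  moreover have "compact (?C \<times> ?C)" by (intro compact_Times energy_sublevel_compact)
  ultimately obtain l \<rho> where l: "strict_mono \<rho>" "((\<lambda>n. (m n, b n)) \<circ> \<rho>) \<longlonglongrightarrow> l"
    unfolding compact_def by (metis (no_types, lifting))
  have mlim: "(\<lambda>n. m (\<rho> n)) \<longlonglongrightarrow> fst l" and blim: "(\<lambda>n. b (\<rho> n)) \<longlonglongrightarrow> snd l"
    using tendsto_fst[OF l(2)] tendsto_snd[OF l(2)] by (simp_all add: o_def)
  have alim': "(\<lambda>n. a (\<rho> n)) \<longlonglongrightarrow> 0"
    using LIMSEQ_subseq_LIMSEQ[OF alim l(1)] by (simp add: o_def)
  have "(\<lambda>n. norm (fst (m (\<rho> n)))) \<longlonglongrightarrow> norm (fst (fst l))"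
    by (intro tendsto_intros mlim)
  moreover have "(\<lambda>n. norm (fst (m (\<rho> n)))) = (\<lambda>n. 1)"
    using norm1 by (simp add: m_def a_def)
  ultimately have norml: "norm (fst (fst l)) = 1" by (simp add: LIMSEQ_const_iff)
  \<comment> \<open>The limit of the contact points lies on the boundary of the orthant and has energy zero.\<close>
  have b0: "snd l = 0"
  proof -
    define Z where "Z = {u :: real ^ 'n. (\<forall>i. 0 \<le> u $ i)} \<inter> (\<Inter>i\<in>- S. {u. u $ i = 0}) \<inter> (\<Union>i\<in>S. {u. u $ i = 0})"
    have "closed Z" unfolding Z_def
      by (intro closed_Int closed_INT closed_UN ballI closed_Collect_all closed_Collect_le closed_Collect_eq
          continuous_intros) simp
    then have "fst (snd l) \<in> Z"
    proof (rule closed_sequentially)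
      show "fst (b (\<rho> n)) \<in> Z" for n
        using touch[of "\<rho> n"] stay[OF T[of "\<rho> n"]] off_support_stays_zero[OF pos[OF s]]
        unfolding Z_def b_def a_def by blast
      show "(\<lambda>n. fst (b (\<rho> n))) \<longlonglongrightarrow> fst (snd l)" by (intro tendsto_intros blim)
    qed
    then obtain i where i: "i \<in> S" "fst (snd l) $ i = 0" and nonneg: "\<And>i. 0 \<le> fst (snd l) $ i"
      and off: "\<And>i. i \<notin> S \<Longrightarrow> fst (snd l) $ i = 0" unfolding Z_def by blast
    have "(\<lambda>n. energy B (b (\<rho> n))) \<longlonglongrightarrow> energy B (snd l)"
      by (rule isCont_tendsto_compose[OF contE blim])
    moreover have "(\<lambda>n. energy B (b (\<rho> n))) \<longlonglongrightarrow> 0"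
      using LIMSEQ_subseq_LIMSEQ[OF Elim l(1)] EC[OF T] by (simp add: o_def b_def)
    ultimately have "energy B (snd l) = 0" by (rule LIMSEQ_unique)
    then have "energy B (fst (snd l), snd (snd l)) \<le> 0" by simp
    from boundary_low_energy_zero[OF S nonneg off i this] show ?thesis by simp
  qed
  have "trapped B (fst l)"
    unfolding trapped_def
  proof
    fix t
    define L where "L = exp (field_lipschitz_const B * \<bar>t\<bar>)"
    have K0: "0 \<le> field_lipschitz_const B" by (rule lipschitz_on_nonneg[OF phase_field_lipschitz])
    have m1: "1 \<le> norm (m n)" for n
      using norm1[of n] norm_fst_le[of "fst (m n)" "snd (m n)"] by (simp add: m_def a_def)
    \<comment> \<open>Start and contact are eventually more than \<open>\<bar>t\<bar>\<close> away in time from the moment of norm 1.\<close>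
    have far: "\<bar>t\<bar> < \<bar>\<tau>\<bar>" if x: "L * norm x < 1" and m: "m n = flow B x \<tau>" for x \<tau> n
    proof (rule ccontr)
      assume "\<not> ?thesis"
      then have "exp (field_lipschitz_const B * \<bar>\<tau>\<bar>) \<le> L"
        using K0 by (auto simp: L_def intro: mult_left_mono)
      then have "exp (field_lipschitz_const B * \<bar>\<tau>\<bar>) * norm x \<le> L * norm x"
        by (rule mult_right_mono) simp
      then show False using norm_flow_le[of B x \<tau>] m1[of n] x m by simp
    qed
    have "(\<lambda>n. L * norm (a (\<rho> n))) \<longlonglongrightarrow> 0" "(\<lambda>n. L * norm (b (\<rho> n))) \<longlonglongrightarrow> 0"
      using tendsto_mult_right_zero[OF tendsto_norm_zero[OF alim'], of L]
        tendsto_mult_right_zero[OF tendsto_norm_zero[OF blim[unfolded b0]], of L] by simp_all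
    then have "\<forall>\<^sub>F n in sequentially. L * norm (a (\<rho> n)) < 1"
      "\<forall>\<^sub>F n in sequentially. L * norm (b (\<rho> n)) < 1"
      by (auto elim: order_tendstoD(2))
    then have ev: "\<forall>\<^sub>F n in sequentially. fst (flow B (m (\<rho> n)) t) \<in> {u. norm u \<le> 1 \<and> (\<forall>i. 0 \<le> u $ i)}"
    proof eventually_elim
      case (elim n)
      have "m (\<rho> n) = flow B (b (\<rho> n)) (r (\<rho> n) - T (\<rho> n))"
        by (simp add: m_def b_def flow_add)
      then have "\<bar>t\<bar> < \<bar>r (\<rho> n) - T (\<rho> n)\<bar>" using far[OF elim(2)] by blast
      moreover have "\<bar>t\<bar> < \<bar>r (\<rho> n)\<bar>" using far[OF elim(1)] by (simp add: m_def)
      ultimately have "r (\<rho> n) + t \<in> {0..T (\<rho> n)}" using r[of "\<rho> n"] by auto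
      from stay[OF this] show ?case by (simp add: m_def flow_add a_def)
    qed
    have "closed {u :: real ^ 'n. norm u \<le> 1 \<and> (\<forall>i. 0 \<le> u $ i)}"
      by (intro closed_Collect_conj closed_Collect_all closed_Collect_le continuous_intros)
    from Lim_in_closed_set[OF this ev sequentially_bot tendsto_fst[OF flow_tendsto[OF mlim tendsto_const]]]
    show "norm (position B (fst l) t) \<le> 1 \<and> (\<forall>i. 0 \<le> position B (fst l) t $ i)" by simp
  qed
  moreover have "fst (fst l) \<noteq> 0" using norml by auto
  ultimately show False using none by blast
qed

text \<open>A function of one coordinate inherits its smoothness and its Laplacian from its profile, which turns
solutions on the line into solutions in every dimension.\<close>

lemma line_deriv_of_profile:
  assumes v: "\<And>s. (v has_real_derivative v' s) (at s)"
  shows "((\<lambda>t. v ((x + t *\<^sub>R axis k 1) $ k0)) has_real_derivative (if k = k0 then v' (x $ k0) else 0)) (at 0)"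
proof (cases "k = k0")
  case True
  have "((\<lambda>t. v (x $ k0 + t)) has_real_derivative v' (x $ k0) * 1) (at 0)"
    by (rule DERIV_chain2[of v]) (auto intro!: derivative_eq_intros v)
  then show ?thesis using True by (simp add: axis_def)
qed (simp add: axis_def)

lemma partial_deriv_profile:
  assumes "\<And>s. (v has_real_derivative v' s) (at s)"
  shows "partial_deriv k (\<lambda>x. v (x $ k0)) = (\<lambda>x. if k = k0 then v' (x $ k0) else 0)"
  unfolding partial_deriv_def by (intro ext DERIV_imp_deriv line_deriv_of_profile assms)

lemma C1_profile:
  assumes v: "\<And>s. (v has_real_derivative v' s) (at s)" and cont: "continuous_on UNIV v'"
  shows "C1_function (\<lambda>x. v (x $ k0))"
  unfolding C1_function_def
proof (intro allI conjI)
  fix k x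
  show "(\<lambda>t. v ((x + t *\<^sub>R axis k 1) $ k0)) differentiable at 0"
    using line_deriv_of_profile[OF v, of x k k0] by (auto simp: real_differentiable_def)
  show "continuous_on UNIV (partial_deriv k (\<lambda>x. v (x $ k0)))"
    unfolding partial_deriv_profile[OF v]
    by (cases "k = k0") (auto intro!: continuous_intros continuous_on_compose2[OF cont])
qed

lemma profile_C2_and_laplacian:
  fixes k0 :: "'m::finite"
  assumes v: "\<And>s. (v has_real_derivative v' s) (at s)" and v': "\<And>s. (v' has_real_derivative v'' s) (at s)"
    and cont: "continuous_on UNIV v''"
  shows "C2_function (\<lambda>x. v (x $ k0))" and "laplacian (\<lambda>x. v (x $ k0)) x = v'' (x $ k0)"
proof -
  have contv': "continuous_on UNIV v'"
    by (rule DERIV_continuous_on) (rule has_field_derivative_at_within[OF v'])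
  have zero: "C1_function (\<lambda>x :: real ^ 'm. 0)"
    using C1_profile[of "\<lambda>_. 0" "\<lambda>_. 0" k0] by simp
  have pd: "partial_deriv k (\<lambda>x. v (x $ k0)) = (if k = k0 then \<lambda>x. v' (x $ k0) else (\<lambda>x. 0))" for k
    unfolding partial_deriv_profile[OF v] by auto
  show "C2_function (\<lambda>x. v (x $ k0))"
    unfolding C2_function_def pd using C1_profile[OF v contv'] C1_profile[OF v' cont] zero by auto
  have "partial_deriv k (\<lambda>x :: real ^ 'm. 0) x = 0" for k
    by (simp add: partial_deriv_def)
  then have "partial_deriv k (partial_deriv k (\<lambda>x. v (x $ k0))) x = (if k = k0 then v'' (x $ k0) else 0)" for k
    unfolding pd by (simp add: partial_deriv_profile[OF v'])
  then show "laplacian (\<lambda>x. v (x $ k0)) x = v'' (x $ k0)"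
    by (simp add: laplacian_def)
qed

lemma profile_system_solution:
  fixes B :: "real ^ 'n ^ 'n" and v :: "'n \<Rightarrow> real \<Rightarrow> real" and k0 :: "'m::finite"
  assumes v: "\<And>i s. (v i has_real_derivative v' i s) (at s)"
    and v': "\<And>i s. (v' i has_real_derivative - (\<Sum>j\<in>UNIV. B $ i $ j * (v j s)\<^sup>2 * v i s)) (at s)"
    and nonneg: "\<And>i s. 0 \<le> v i s"
  shows "cubic_system_solution B (\<lambda>i x. v i (x $ k0))"
proof -
  have "continuous_on UNIV (v i)" for i
    by (rule DERIV_continuous_on) (rule has_field_derivative_at_within[OF v])
  then have cont: "continuous_on UNIV (\<lambda>s. - (\<Sum>j\<in>UNIV. B $ i $ j * (v j s)\<^sup>2 * v i s))" for i
    by (intro continuous_intros)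
  show ?thesis
    unfolding cubic_system_solution_def
    using profile_C2_and_laplacian[OF v v' cont, of _ k0] nonneg by auto
qed

lemma solution_if_zero_diagonal:
  fixes B :: "real ^ 'n ^ 'n"
  assumes "B $ k $ k = 0"
  shows "\<exists>u :: 'n \<Rightarrow> real ^ 'm \<Rightarrow> real. cubic_system_solution B u \<and> nontrivial u"
proof -
  let ?v = "\<lambda>i (s :: real). if i = k then 1 else 0 :: real"
  have z: "(\<Sum>j\<in>UNIV. B $ i $ j * (?v j s)\<^sup>2 * ?v i s) = 0" for i s
    using assms by (intro sum.neutral) auto
  have "cubic_system_solution B (\<lambda>i (x :: real ^ 'm). ?v i (x $ undefined))"
    by (rule profile_system_solution[where v' = "\<lambda>_ _. 0"]) (auto simp only: z minus_zero DERIV_const, simp)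
  moreover have "nontrivial (\<lambda>i (x :: real ^ 'm). ?v i (x $ undefined))"
    unfolding nontrivial_def by (intro exI[of _ k]) (simp add: fun_eq_iff)
  ultimately show ?thesis by blast
qed

lemma solution_if_trapped:
  fixes B :: "real ^ 'n ^ 'n"
  assumes a: "fst a \<noteq> 0" and tr: "trapped B a"
  shows "\<exists>u :: 'n \<Rightarrow> real ^ 'm \<Rightarrow> real. cubic_system_solution B u \<and> nontrivial u"
proof -
  let ?v = "\<lambda>i s. position B a s $ i"
  have le1: "\<bar>?v i s\<bar> \<le> 1" for i s
    using component_le_norm_cart[of "position B a s" i] tr unfolding trapped_def by (meson order_trans)
  have "cubic_system_solution B (\<lambda>i (x :: real ^ 'm). ?v i (x $ undefined))"
  proof (rule profile_system_solution)
    show "(?v i has_real_derivative velocity B a s $ i) (at s)" for i s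
      by (rule position_component_deriv)
    show "((\<lambda>s. velocity B a s $ i) has_real_derivative - (\<Sum>j\<in>UNIV. B $ i $ j * (?v j s)\<^sup>2 * ?v i s)) (at s)" for i s
      using velocity_component_deriv[of B a i s] by (simp add: clamped_force_def clamp1_eq le1)
    show "0 \<le> ?v i s" for i s using tr by (simp add: trapped_def)
  qed
  moreover have "nontrivial (\<lambda>i (x :: real ^ 'm). ?v i (x $ undefined))"
  proof -
    obtain i where i: "fst a $ i \<noteq> 0" using a by (auto simp: vec_eq_iff)
    have "(\<lambda>x :: real ^ 'm. ?v i (x $ undefined)) 0 \<noteq> 0" using i by simp
    then show ?thesis unfolding nontrivial_def by (metis (mono_tags, lifting))
  qed
  ultimately show ?thesis by blast
qed

text \<open>If no diagonal entry vanishes, choose a nonnegative vector with nonpositive form value and support of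
least cardinality; the initial position \<open>q\<close> consists of the square roots of its entries because the
potential is the form evaluated at the squares.\<close>

theorem solution_if_not_strictly_copositive:
  fixes B :: "real ^ 'n ^ 'n"
  assumes sym: "transpose B = B" and diag: "\<And>i. 0 \<le> B $ i $ i" and ncop: "\<not> strictly_copositive B"
  shows "\<exists>u :: 'n \<Rightarrow> real ^ 'm \<Rightarrow> real. cubic_system_solution B u \<and> nontrivial u"
proof (cases "\<exists>k. B $ k $ k = 0")
  case True
  then show ?thesis using solution_if_zero_diagonal by blast
next
  case False
  then have diag_pos: "0 < B $ k $ k" for k using diag[of k] by (simp add: less_le)
  let ?supp = "\<lambda>c :: real ^ 'n. {i. c $ i \<noteq> 0}"
  define P where "P = (\<lambda>c. (\<forall>i. 0 \<le> c $ i) \<and> c \<noteq> 0 \<and> quad_form B c \<le> 0)"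
  obtain c0 where "P c0"
    using ncop unfolding strictly_copositive_def nonneg_orthant_def P_def quad_form_def by (auto simp: not_less)
  then obtain c where c: "P c" and min: "\<And>d. P d \<Longrightarrow> card (?supp c) \<le> card (?supp d)"
    using ex_has_least_nat[of P c0 "\<lambda>c. card (?supp c)"] by blast
  have S: "positive_on_proper_faces B (?supp c)"
    unfolding positive_on_proper_faces_def
  proof (intro allI impI)
    fix d assume d: "(\<forall>i. 0 \<le> d $ i) \<and> d \<noteq> 0 \<and> ?supp d \<subset> ?supp c"
    then have "card (?supp d) < card (?supp c)" by (intro psubset_card_mono) auto
    then have "\<not> P d" using min[of d] by linarith
    then show "0 < quad_form B d" using d unfolding P_def by auto
  qed
  define q where "q = (\<chi> i. sqrt (c $ i))"
  have nonneg: "0 \<le> c $ i" for i using c by (simp add: P_def)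
  then have "squares q = c" by (simp add: squares_def q_def vec_eq_iff)
  then have E: "quad_form B (squares q) \<le> 0" using c by (simp add: P_def)
  have q: "positive_exactly_on (?supp c) q"
    using nonneg by (auto simp: positive_exactly_on_def q_def less_le)
  obtain k where "c $ k \<noteq> 0" using c by (auto simp: P_def vec_eq_iff)
  then obtain a where "fst a \<noteq> 0" "trapped B a"
    using exists_trapped[OF sym S q E _ diag_pos[of k]] by auto
  then show ?thesis by (rule solution_if_trapped)
qed

section \<open>Strict positivity and a cutoff inequality in the plane\<close>

lemma second_derivative_nonneg_at_min:
  fixes f :: "real \<Rightarrow> real"
  assumes f: "\<And>x. (f has_real_derivative f' x) (at x)" and f': "(f' has_real_derivative f'') (at x0)"
    and d: "0 < d" and min: "\<And>x. \<bar>x - x0\<bar> < d \<Longrightarrow> f x0 \<le> f x"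
  shows "0 \<le> f''"
proof (rule ccontr)
  assume "\<not> 0 \<le> f''"
  then have neg: "f'' < 0" by simp
  have zero: "f' x0 = 0"
    by (rule DERIV_local_min[OF f d]) (use min in \<open>simp add: abs_minus_commute\<close>)
  from DERIV_neg_dec_right[OF f' neg] obtain r where r: "0 < r" "\<And>h. 0 < h \<Longrightarrow> h < r \<Longrightarrow> f' (x0 + h) < 0"
    using zero by auto
  define h where "h = min r d / 2"
  have h: "0 < h" "h < r" "h < d" using r d by (auto simp: h_def)
  have "f (x0 + h) < f x0"
  proof (rule DERIV_neg_imp_decreasing_open[of x0 "x0 + h" f])
    fix x :: real assume "x0 < x" "x < x0 + h"
    then have "f' x < 0" using r(2)[of "x - x0"] h by simp
    then show "\<exists>D. (f has_real_derivative D) (at x) \<and> D < 0" using f by blast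
  next
    show "continuous_on {x0..x0 + h} f"
      by (rule DERIV_continuous_on) (rule has_field_derivative_at_within[OF f])
  qed (use h in simp)
  moreover have "f x0 \<le> f (x0 + h)" using min[of "x0 + h"] h by simp
  ultimately show False by simp
qed

definition jointly_continuous :: "(real \<Rightarrow> real \<Rightarrow> real) \<Rightarrow> bool" where
  "jointly_continuous f \<longleftrightarrow> continuous_on UNIV (\<lambda>p. f (fst p) (snd p))"

text \<open>Functions on the plane are curried, and their derivatives are carried along as explicit arguments. In this way
functions of one variable are covered by taking the derivatives in the second variable to be zero, and integrals
can be iterated.\<close>

definition plane_C1 :: "(real \<Rightarrow> real \<Rightarrow> real) \<Rightarrow> (real \<Rightarrow> real \<Rightarrow> real) \<Rightarrow> (real \<Rightarrow> real \<Rightarrow> real) \<Rightarrow> bool" where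
  "plane_C1 f fs ft \<longleftrightarrow> jointly_continuous f \<and> jointly_continuous fs \<and> jointly_continuous ft \<and>
     (\<forall>s t. ((\<lambda>s. f s t) has_real_derivative fs s t) (at s)) \<and>
     (\<forall>s t. ((\<lambda>t. f s t) has_real_derivative ft s t) (at t))"

definition plane_C2 :: "(real \<Rightarrow> real \<Rightarrow> real) \<Rightarrow> (real \<Rightarrow> real \<Rightarrow> real) \<Rightarrow> (real \<Rightarrow> real \<Rightarrow> real) \<Rightarrow>
    (real \<Rightarrow> real \<Rightarrow> real) \<Rightarrow> (real \<Rightarrow> real \<Rightarrow> real) \<Rightarrow> bool" where
  "plane_C2 f fs ft fss ftt \<longleftrightarrow> plane_C1 f fs ft \<and> jointly_continuous fss \<and> jointly_continuous ftt \<and>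
     (\<forall>s t. ((\<lambda>s. fs s t) has_real_derivative fss s t) (at s)) \<and>
     (\<forall>s t. ((\<lambda>t. ft s t) has_real_derivative ftt s t) (at t))"

lemma jointly_continuous_compose:
  assumes "jointly_continuous f" "continuous_on X g" "continuous_on X h"
  shows "continuous_on X (\<lambda>x. f (g x) (h x))"
  using continuous_on_compose2[OF assms(1)[unfolded jointly_continuous_def] continuous_on_Pair[OF assms(2,3)]] by simp

text \<open>A maximum principle that needs no connectedness argument. Let \<open>f\<close> be at least \<open>m > 0\<close> on a disc of radius
\<open>\<rho>\<close> around \<open>(a, b)\<close>, and choose \<open>R\<close> so large that the disc of radius \<open>R\<close> contains the
target point. Let \<open>q\<close> be the squared distance to \<open>(a, b)\<close>. For large \<open>\<alpha>\<close> the function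
\<open>exp (- \<alpha> q) - exp (- \<alpha> R\<^sup>2)\<close> is so strongly subharmonic on the annulus \<open>\<rho>\<^sup>2 \<le> q \<le> R\<^sup>2\<close> that \<open>f\<close> minus \<open>m\<close> times it
cannot have a negative minimum in the interior; on both boundary circles it is nonnegative. So \<open>f\<close> is positive
inside the whole disc.\<close>

lemma positivity_propagates:
  fixes f :: "real \<Rightarrow> real \<Rightarrow> real"
  assumes f: "plane_C2 f fs ft fss ftt" and c: "jointly_continuous c"
    and eq: "\<And>s t. fss s t + ftt s t = - c s t * f s t" and nonneg: "\<And>s t. 0 \<le> f s t"
    and pos: "0 < f a b"
  shows "0 < f s1 t1"
proof -
  have jf: "jointly_continuous f" using f by (simp add: plane_C2_def plane_C1_def)
  define q where "q = (\<lambda>s t :: real. (s - a)\<^sup>2 + (t - b)\<^sup>2)"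
  have contq: "continuous_on X (\<lambda>p. q (fst p) (snd p))" for X
    unfolding q_def by (intro continuous_intros)
  have contf: "continuous_on X (\<lambda>p. f (fst p) (snd p))" for X
    by (intro jointly_continuous_compose[OF jf] continuous_intros)
  have dist_q: "(dist p (a, b))\<^sup>2 = q (fst p) (snd p)" for p :: "real \<times> real"
    by (simp add: dist_prod_def q_def dist_real_def)
  define m where "m = f a b / 2"
  have m: "0 < m" using pos by (simp add: m_def)
  obtain \<rho> where \<rho>: "0 < \<rho>" "\<And>s t. q s t \<le> \<rho>\<^sup>2 \<Longrightarrow> m \<le> f s t"
  proof -
    have "\<exists>d>0. \<forall>p. dist p (a, b) < d \<longrightarrow> dist (f (fst p) (snd p)) (f a b) < m"
      using contf[of UNIV] m unfolding continuous_on_iff by (metis UNIV_I fst_conv snd_conv)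
    then obtain d where d: "0 < d" "\<And>p. dist p (a, b) < d \<Longrightarrow> dist (f (fst p) (snd p)) (f a b) < m" by blast
    have "m \<le> f s t" if "q s t \<le> (d / 2)\<^sup>2" for s t
    proof -
      have "dist (s, t) (a, b) \<le> d / 2"
        by (rule power2_le_imp_le) (use that d dist_q[of "(s, t)"] in auto)
      then have "dist (f s t) (f a b) < m" using d(2)[of "(s, t)"] d(1) by simp
      then show ?thesis unfolding dist_real_def m_def by linarith
    qed
    then show thesis using that[of "d / 2"] d by simp
  qed
  define R where "R = sqrt (q s1 t1) + \<rho> + 1"
  have q0: "0 \<le> q s t" for s t by (simp add: q_def)
  have R: "\<rho> < R" "q s1 t1 < R\<^sup>2"
  proof -
    show "\<rho> < R" using q0 by (simp add: R_def add_nonneg_pos)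
    have "(sqrt (q s1 t1))\<^sup>2 < R\<^sup>2" using \<rho> q0 by (intro power_strict_mono) (auto simp: R_def)
    then show "q s1 t1 < R\<^sup>2" using q0 by simp
  qed
  define ball where "ball = {p :: real \<times> real. q (fst p) (snd p) \<le> R\<^sup>2}"
  have compball: "compact ball"
  proof -
    have "ball = cball (a, b) R"
      unfolding ball_def using R \<rho>
      by (auto simp: dist_q[symmetric] dist_commute intro: power_mono power2_le_imp_le)
    then show ?thesis by simp
  qed
  have "bounded ((\<lambda>p. c (fst p) (snd p)) ` ball)"
    by (intro compact_imp_bounded compact_continuous_image compball jointly_continuous_compose[OF c] continuous_intros)
  then obtain K0 where K0: "\<And>p. p \<in> ball \<Longrightarrow> \<bar>c (fst p) (snd p)\<bar> \<le> K0"
    unfolding bounded_iff by auto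
  define K where "K = max K0 1"
  have K: "0 < K" "\<And>s t. q s t \<le> R\<^sup>2 \<Longrightarrow> \<bar>c s t\<bar> \<le> K"
    using K0 by (force simp: K_def ball_def)+
  \<comment> \<open>With this choice \<open>4 \<alpha> (\<alpha> x - 1) \<ge> K\<close> for \<open>x \<ge> \<rho>\<^sup>2\<close>, where \<open>K\<close> bounds \<open>\<bar>c\<bar>\<close> on the large disc.\<close>
  define \<alpha> where "\<alpha> = 1 / \<rho>\<^sup>2 + K / 4"
  have \<alpha>0: "0 < \<alpha>" using \<rho> K by (simp add: \<alpha>_def add_pos_pos)
  have \<alpha>: "K \<le> 4 * \<alpha>\<^sup>2 * x - 4 * \<alpha>" if "\<rho>\<^sup>2 \<le> x" for x
  proof -
    have e: "\<alpha> * \<rho>\<^sup>2 = 1 + K * \<rho>\<^sup>2 / 4" using \<rho> by (simp add: \<alpha>_def field_simps)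
    have "K * 1 \<le> K * (\<alpha> * \<rho>\<^sup>2)" using K by (intro mult_left_mono) (auto simp: e)
    also have "\<dots> = 4 * \<alpha> * (\<alpha> * \<rho>\<^sup>2 - 1)" by (simp add: e)
    also have "\<dots> \<le> 4 * \<alpha> * (\<alpha> * x - 1)" using \<alpha>0 that by (intro mult_left_mono diff_mono) auto
    finally show ?thesis by (simp add: algebra_simps power2_eq_square)
  qed
  define w where "w = (\<lambda>s t. f s t - m * (exp (- \<alpha> * q s t) - exp (- \<alpha> * R\<^sup>2)))"
  have contw: "continuous_on X (\<lambda>p. w (fst p) (snd p))" for X
    unfolding w_def by (intro continuous_intros contq contf)
  define A where "A = {p \<in> ball. \<rho>\<^sup>2 \<le> q (fst p) (snd p)}"
  have "closed A" unfolding A_def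
    by (intro continuous_on_closed_Collect_le continuous_on_const contq compact_imp_closed compball)
  then have compA: "compact A" unfolding A_def
    by (metis (no_types, lifting) compball compact_Int_closed Int_absorb1 mem_Collect_eq subsetI)
  have "(a + R, b) \<in> A" using R \<rho> by (auto simp: A_def ball_def q_def intro: power_mono)
  then obtain p0 where p0: "p0 \<in> A" "\<And>p. p \<in> A \<Longrightarrow> w (fst p0) (snd p0) \<le> w (fst p) (snd p)"
    using continuous_attains_inf[OF compA _ contw] by blast
  obtain s0 t0 where p0_eq: "p0 = (s0, t0)" by (cases p0)
  have q_p0: "\<rho>\<^sup>2 \<le> q s0 t0" "q s0 t0 \<le> R\<^sup>2" using p0(1) by (auto simp: A_def ball_def p0_eq)
  have "0 \<le> w s0 t0"
  proof (rule ccontr)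
    assume "\<not> ?thesis"
    then have wneg: "w s0 t0 < 0" by simp
    have "q s0 t0 \<noteq> R\<^sup>2" using wneg nonneg[of s0 t0] by (auto simp: w_def)
    moreover have "q s0 t0 \<noteq> \<rho>\<^sup>2"
    proof
      assume e: "q s0 t0 = \<rho>\<^sup>2"
      have "m * (exp (- \<alpha> * q s0 t0) - exp (- \<alpha> * R\<^sup>2)) \<le> m * 1"
        using m \<alpha>0 q0[of s0 t0] by (intro mult_left_mono) (auto intro: order_trans[of _ "exp (- \<alpha> * q s0 t0)"])
      then show False using \<rho>(2)[of s0 t0] e wneg by (simp add: w_def)
    qed
    ultimately have strict: "q s0 t0 \<in> {\<rho>\<^sup>2<..<R\<^sup>2}" using q_p0 by simp
    have "open {p. q (fst p) (snd p) \<in> {\<rho>\<^sup>2<..<R\<^sup>2}}"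
      using open_vimage[OF open_greaterThanLessThan contq[of UNIV]] by (simp add: vimage_def)
    then obtain d where d: "0 < d" "\<And>p. dist p (s0, t0) < d \<Longrightarrow> q (fst p) (snd p) \<in> {\<rho>\<^sup>2<..<R\<^sup>2}"
      using strict unfolding open_dist by (metis (no_types, lifting) fst_conv mem_Collect_eq snd_conv)
    have minw: "w s0 t0 \<le> w s t" if "dist (s, t) (s0, t0) < d" for s t
      using p0(2)[of "(s, t)"] d(2)[OF that] by (auto simp: p0_eq A_def ball_def)
    define E where "E = exp (- \<alpha> * q s0 t0)"
    let ?ws = "\<lambda>s t. fs s t - m * (exp (- \<alpha> * q s t) * (- \<alpha> * (2 * (s - a))))"
    let ?wt = "\<lambda>s t. ft s t - m * (exp (- \<alpha> * q s t) * (- \<alpha> * (2 * (t - b))))"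
    have "0 \<le> fss s0 t0 - m * (E * (4 * \<alpha>\<^sup>2 * (s0 - a)\<^sup>2 - 2 * \<alpha>))"
    proof (rule second_derivative_nonneg_at_min[OF _ _ d(1)])
      show "((\<lambda>s. w s t0) has_real_derivative ?ws s t0) (at s)" for s
        using f unfolding plane_C2_def plane_C1_def w_def q_def
        by (auto intro!: derivative_eq_intros)
      show "((\<lambda>s. ?ws s t0) has_real_derivative fss s0 t0 - m * (E * (4 * \<alpha>\<^sup>2 * (s0 - a)\<^sup>2 - 2 * \<alpha>))) (at s0)"
        using f unfolding plane_C2_def q_def E_def
        by (auto intro!: derivative_eq_intros simp: algebra_simps power2_eq_square)
      show "w s0 t0 \<le> w s t0" if "\<bar>s - s0\<bar> < d" for s
        using minw[of s t0] that by (simp add: dist_prod_def dist_real_def)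
    qed
    moreover have "0 \<le> ftt s0 t0 - m * (E * (4 * \<alpha>\<^sup>2 * (t0 - b)\<^sup>2 - 2 * \<alpha>))"
    proof (rule second_derivative_nonneg_at_min[OF _ _ d(1)])
      show "((\<lambda>t. w s0 t) has_real_derivative ?wt s0 t) (at t)" for t
        using f unfolding plane_C2_def plane_C1_def w_def q_def
        by (auto intro!: derivative_eq_intros)
      show "((\<lambda>t. ?wt s0 t) has_real_derivative ftt s0 t0 - m * (E * (4 * \<alpha>\<^sup>2 * (t0 - b)\<^sup>2 - 2 * \<alpha>))) (at t0)"
        using f unfolding plane_C2_def q_def E_def
        by (auto intro!: derivative_eq_intros simp: algebra_simps power2_eq_square)
      show "w s0 t0 \<le> w s0 t" if "\<bar>t - t0\<bar> < d" for t
        using minw[of s0 t] that by (simp add: dist_prod_def dist_real_def)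
    qed
    ultimately have "0 \<le> (fss s0 t0 + ftt s0 t0) - m * E * (4 * \<alpha>\<^sup>2 * q s0 t0 - 4 * \<alpha>)"
      by (simp add: q_def algebra_simps)
    also have "\<dots> \<le> K * f s0 t0 - m * E * K"
    proof (intro diff_mono mult_left_mono \<alpha> q_p0)
      have "- c s0 t0 \<le> K" using K(2)[of s0 t0] q_p0 by simp
      then show "fss s0 t0 + ftt s0 t0 \<le> K * f s0 t0"
        unfolding eq by (intro mult_right_mono nonneg)
    qed (use m in \<open>simp add: E_def\<close>)
    also have "\<dots> = K * w s0 t0 - K * m * exp (- \<alpha> * R\<^sup>2)"
      by (simp add: w_def E_def algebra_simps)
    finally have "0 \<le> K * w s0 t0 - K * m * exp (- \<alpha> * R\<^sup>2)" .
    moreover have "K * w s0 t0 < 0" using K(1) wneg by (rule mult_pos_neg)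
    moreover have "0 \<le> K * m * exp (- \<alpha> * R\<^sup>2)" using K(1) m by simp
    ultimately show False by linarith
  qed
  show ?thesis
  proof (cases "q s1 t1 \<le> \<rho>\<^sup>2")
    case True
    then show ?thesis using \<rho>(2)[of s1 t1] m by simp
  next
    case False
    then have "(s1, t1) \<in> A" using R by (simp add: A_def ball_def)
    then have "0 \<le> w s1 t1" using p0(2)[of "(s1, t1)"] \<open>0 \<le> w s0 t0\<close> by (simp add: p0_eq)
    moreover have "exp (- \<alpha> * R\<^sup>2) < exp (- \<alpha> * q s1 t1)" using \<alpha>0 R by simp
    then have "0 < m * (exp (- \<alpha> * q s1 t1) - exp (- \<alpha> * R\<^sup>2))" using m by simp
    ultimately show ?thesis by (simp add: w_def)
  qed
qed

definition integral_over_square :: "real \<Rightarrow> (real \<Rightarrow> real \<Rightarrow> real) \<Rightarrow> real" where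
  "integral_over_square R h = integral {-R..R} (\<lambda>s. integral {-R..R} (\<lambda>t. h s t))"

lemma jointly_continuous_prod: "jointly_continuous h \<Longrightarrow> continuous_on X (\<lambda>(s, t). h s t)"
  unfolding case_prod_beta
  by (rule jointly_continuous_compose[OF _ continuous_on_fst[OF continuous_on_id] continuous_on_snd[OF continuous_on_id]])

lemma inner_integrable: "jointly_continuous h \<Longrightarrow> (\<lambda>t. h s t) integrable_on {c..d}"
  by (rule integrable_continuous_real) (rule jointly_continuous_compose[OF _ continuous_on_const continuous_on_id])

lemma outer_continuous:
  assumes "jointly_continuous h"
  shows "continuous_on X (\<lambda>s. integral {c..d} (\<lambda>t. h s t))"
proof -
  from integral_continuous_on_param[OF jointly_continuous_prod[OF assms, of "X \<times> cbox c d"]] show ?thesis by simp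
qed

lemma outer_integrable: "jointly_continuous h \<Longrightarrow> (\<lambda>s. integral {c..d} (\<lambda>t. h s t)) integrable_on {x..y}"
  by (intro integrable_continuous_real outer_continuous)

lemma integral_over_square_add:
  assumes g: "jointly_continuous g" and h: "jointly_continuous h"
  shows "integral_over_square R (\<lambda>s t. g s t + h s t) = integral_over_square R g + integral_over_square R h"
proof -
  have "integral {-R..R} (\<lambda>t. g s t + h s t) = integral {-R..R} (\<lambda>t. g s t) + integral {-R..R} (\<lambda>t. h s t)" for s
    by (rule integral_add[OF inner_integrable[OF g] inner_integrable[OF h]])
  then show ?thesis
    unfolding integral_over_square_def by (simp only: integral_add[OF outer_integrable[OF g] outer_integrable[OF h]])
qed

lemma integral_over_square_cmult: "integral_over_square R (\<lambda>s t. c * h s t) = c * integral_over_square R h"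
  unfolding integral_over_square_def integral_mult_right ..

lemma integral_over_square_mono:
  assumes g: "jointly_continuous g" and h: "jointly_continuous h" and le: "\<And>s t. g s t \<le> h s t"
  shows "integral_over_square R g \<le> integral_over_square R h"
  unfolding integral_over_square_def
  by (rule integral_le[OF outer_integrable[OF g] outer_integrable[OF h]])
    (rule integral_le[OF inner_integrable[OF g] inner_integrable[OF h] le])

lemma integral_over_square_nonneg:
  assumes h: "jointly_continuous h" and nonneg: "\<And>s t. 0 \<le> h s t"
  shows "0 \<le> integral_over_square R h"
  unfolding integral_over_square_def
  by (rule integral_nonneg[OF outer_integrable[OF h]]) (rule integral_nonneg[OF inner_integrable[OF h] nonneg])

lemma jointly_continuous_sum: "(\<And>i. i \<in> I \<Longrightarrow> jointly_continuous (h i)) \<Longrightarrow> jointly_continuous (\<lambda>s t. \<Sum>i\<in>I. h i s t)"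
  unfolding jointly_continuous_def by (intro continuous_intros)

lemma jointly_continuous_add: "jointly_continuous g \<Longrightarrow> jointly_continuous h \<Longrightarrow> jointly_continuous (\<lambda>s t. g s t + h s t)"
  unfolding jointly_continuous_def by (intro continuous_intros)

lemma jointly_continuous_mult: "jointly_continuous g \<Longrightarrow> jointly_continuous h \<Longrightarrow> jointly_continuous (\<lambda>s t. g s t * h s t)"
  unfolding jointly_continuous_def by (intro continuous_intros)

lemma jointly_continuous_power: "jointly_continuous g \<Longrightarrow> jointly_continuous (\<lambda>s t. (g s t) ^ n)"
  unfolding jointly_continuous_def by (intro continuous_intros)

lemma jointly_continuous_const: "jointly_continuous (\<lambda>s t. c)"
  unfolding jointly_continuous_def by (intro continuous_intros)

lemma integral_over_square_sum:
  assumes "finite I" "\<And>i. i \<in> I \<Longrightarrow> jointly_continuous (h i)"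
  shows "integral_over_square R (\<lambda>s t. \<Sum>i\<in>I. h i s t) = (\<Sum>i\<in>I. integral_over_square R (h i))"
  using assms
proof (induction I rule: finite_induct)
  case empty
  then show ?case by (simp add: integral_over_square_def)
next
  case (insert i I)
  then have "jointly_continuous (\<lambda>s t. \<Sum>i\<in>I. h i s t)" by (intro jointly_continuous_sum) auto
  from integral_over_square_add[OF insert.prems[of i] this] show ?case
    using insert by simp
qed

lemma integral_over_square_deriv_fst:
  assumes g: "\<And>s t. ((\<lambda>s. g s t) has_real_derivative g' s t) (at s)" and cont: "jointly_continuous g'" and R: "0 \<le> R"
    and bd: "\<And>t. g R t = 0" "\<And>t. g (- R) t = 0"
  shows "integral_over_square R g' = 0"
proof -
  have "integral_over_square R g' = integral {-R..R} (\<lambda>t. integral {-R..R} (\<lambda>s. g' s t))"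
    unfolding integral_over_square_def cbox_interval[symmetric]
    by (rule integral_swap_continuous[OF jointly_continuous_prod[OF cont]])
  also have "\<dots> = integral {-R..R} (\<lambda>t. 0 :: real)"
  proof (intro integral_cong)
    fix t
    have "((\<lambda>s. g' s t) has_integral g R t - g (- R) t) {-R..R}"
      using R g by (intro fundamental_theorem_of_calculus)
        (auto simp: has_real_derivative_iff_has_vector_derivative[symmetric] intro: has_field_derivative_at_within)
    then show "integral {-R..R} (\<lambda>s. g' s t) = 0" using bd by (simp add: integral_unique)
  qed
  finally show ?thesis by simp
qed

lemma integral_over_square_deriv_snd:
  assumes g: "\<And>s t. ((\<lambda>t. g s t) has_real_derivative g' s t) (at t)" and R: "0 \<le> R"
    and bd: "\<And>s. g s R = 0" "\<And>s. g s (- R) = 0"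
  shows "integral_over_square R g' = 0"
proof -
  have "integral {-R..R} (\<lambda>t. g' s t) = 0" for s
  proof -
    have "((\<lambda>t. g' s t) has_integral g s R - g s (- R)) {-R..R}"
      using R g by (intro fundamental_theorem_of_calculus)
        (auto simp: has_real_derivative_iff_has_vector_derivative[symmetric] intro: has_field_derivative_at_within)
    then show ?thesis using bd by (simp add: integral_unique)
  qed
  then show ?thesis by (simp add: integral_over_square_def)
qed

text \<open>Integrate the divergence of the vector field \<open>\<phi>\<^sup>2 \<nabla>U / U\<close>, which vanishes on the boundary of the square. The terms with
\<open>\<nabla>U / U\<close> are absorbed by completing the square.\<close>

lemma positive_supersolution_inequality:
  assumes U: "plane_C2 U Us Ut Uss Utt" and Upos: "\<And>s t. 0 < U s t" and V: "jointly_continuous V"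
    and eq: "\<And>s t. Uss s t + Utt s t = - V s t * U s t"
    and \<phi>: "plane_C1 \<phi> \<phi>s \<phi>t" and R: "0 \<le> R"
    and bd: "\<And>t. \<phi> R t = 0" "\<And>t. \<phi> (- R) t = 0" "\<And>s. \<phi> s R = 0" "\<And>s. \<phi> s (- R) = 0"
  shows "integral_over_square R (\<lambda>s t. V s t * (\<phi> s t)\<^sup>2) \<le> integral_over_square R (\<lambda>s t. (\<phi>s s t)\<^sup>2 + (\<phi>t s t)\<^sup>2)"
proof -
  have cont: "jointly_continuous U" "jointly_continuous Us" "jointly_continuous Ut" "jointly_continuous Uss" "jointly_continuous Utt" "jointly_continuous \<phi>" "jointly_continuous \<phi>s" "jointly_continuous \<phi>t"
    using U \<phi> by (auto simp: plane_C2_def plane_C1_def)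
  have U0: "U s t \<noteq> 0" for s t using Upos[of s t] by simp
  let ?gs = "\<lambda>s t. 2 * \<phi> s t * \<phi>s s t * (Us s t / U s t) + (\<phi> s t)\<^sup>2 * (Uss s t / U s t) - (\<phi> s t)\<^sup>2 * (Us s t / U s t)\<^sup>2"
  let ?gt = "\<lambda>s t. 2 * \<phi> s t * \<phi>t s t * (Ut s t / U s t) + (\<phi> s t)\<^sup>2 * (Utt s t / U s t) - (\<phi> s t)\<^sup>2 * (Ut s t / U s t)\<^sup>2"
  have jgs: "jointly_continuous ?gs" and jgt: "jointly_continuous ?gt"
    using cont U0 unfolding jointly_continuous_def by (auto intro!: continuous_intros)
  have "integral_over_square R ?gs = 0"
  proof (rule integral_over_square_deriv_fst[OF _ jgs R])
    show "((\<lambda>s. (\<phi> s t)\<^sup>2 * (Us s t / U s t)) has_real_derivative ?gs s t) (at s)" for s t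
      using U \<phi> U0 unfolding plane_C2_def plane_C1_def
      by (auto intro!: derivative_eq_intros simp: field_simps power2_eq_square)
  qed (simp_all add: bd)
  moreover have "integral_over_square R ?gt = 0"
  proof (rule integral_over_square_deriv_snd[OF _ R])
    show "((\<lambda>t. (\<phi> s t)\<^sup>2 * (Ut s t / U s t)) has_real_derivative ?gt s t) (at t)" for s t
      using U \<phi> U0 unfolding plane_C2_def plane_C1_def
      by (auto intro!: derivative_eq_intros simp: field_simps power2_eq_square)
  qed (simp_all add: bd)
  ultimately have "integral_over_square R (\<lambda>s t. V s t * (\<phi> s t)\<^sup>2)
      = integral_over_square R (\<lambda>s t. V s t * (\<phi> s t)\<^sup>2 + (?gs s t + ?gt s t))"
    using integral_over_square_add[OF jointly_continuous_mult[OF V jointly_continuous_power[OF cont(6), of 2]] jointly_continuous_add[OF jgs jgt], of R]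
      integral_over_square_add[OF jgs jgt, of R] by simp
  also have "\<dots> \<le> integral_over_square R (\<lambda>s t. (\<phi>s s t)\<^sup>2 + (\<phi>t s t)\<^sup>2)"
  proof (rule integral_over_square_mono)
    show "jointly_continuous (\<lambda>s t. V s t * (\<phi> s t)\<^sup>2 + (?gs s t + ?gt s t))"
      by (intro jointly_continuous_add jointly_continuous_mult jointly_continuous_power V cont jgs jgt)
    show "jointly_continuous (\<lambda>s t. (\<phi>s s t)\<^sup>2 + (\<phi>t s t)\<^sup>2)"
      by (intro jointly_continuous_add jointly_continuous_power cont)
    fix s t
    let ?x = "Us s t / U s t" and ?y = "Ut s t / U s t"
    have cancel: "(- p - q) * f + ((A + f * p - C) + (A' + f * q - D)) = A - C + (A' - D)" for p q f A A' C D :: real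
      by (simp add: algebra_simps)
    have square: "2 * f * a * x - f\<^sup>2 * x\<^sup>2 + (2 * f * b * y - f\<^sup>2 * y\<^sup>2)
        = a\<^sup>2 - (a - f * x)\<^sup>2 + (b\<^sup>2 - (b - f * y)\<^sup>2)" for f a b x y :: real
      by (simp add: algebra_simps power2_eq_square)
    have V_eq: "V s t = - (Uss s t / U s t) - Utt s t / U s t"
      using eq[of s t] U0[of s t] by (simp add: field_simps)
    have "V s t * (\<phi> s t)\<^sup>2 + (?gs s t + ?gt s t)
        = 2 * \<phi> s t * \<phi>s s t * ?x - (\<phi> s t)\<^sup>2 * ?x\<^sup>2 + (2 * \<phi> s t * \<phi>t s t * ?y - (\<phi> s t)\<^sup>2 * ?y\<^sup>2)"
      unfolding V_eq by (rule cancel)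
    also have "\<dots> = (\<phi>s s t)\<^sup>2 - (\<phi>s s t - \<phi> s t * ?x)\<^sup>2 + ((\<phi>t s t)\<^sup>2 - (\<phi>t s t - \<phi> s t * ?y)\<^sup>2)"
      by (rule square)
    also have "\<dots> \<le> (\<phi>s s t)\<^sup>2 + (\<phi>t s t)\<^sup>2" by simp
    finally show "V s t * (\<phi> s t)\<^sup>2 + (?gs s t + ?gt s t) \<le> (\<phi>s s t)\<^sup>2 + (\<phi>t s t)\<^sup>2" .
  qed
  finally show ?thesis .
qed

section \<open>A Liouville theorem for strictly copositive matrices\<close>

lemma pos_part_square_deriv:
  "((\<lambda>x. (max 0 x)\<^sup>2) has_real_derivative 2 * max 0 x) (at (x :: real))"
proof (cases "x = 0")
  case False
  then have "x < 0 \<or> 0 < x" by auto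
  then show ?thesis
  proof
    assume x: "x < 0"
    have "((\<lambda>x :: real. 0) has_real_derivative 0) (at x)" by simp
    then have "((\<lambda>x. (max 0 x)\<^sup>2) has_real_derivative 0) (at x)"
      by (rule has_field_derivative_transform_within_open[where S = "{..<0}"]) (use x in auto)
    then show ?thesis using x by simp
  next
    assume x: "0 < x"
    have "((\<lambda>x :: real. x\<^sup>2) has_real_derivative 2 * x) (at x)" by (auto intro!: derivative_eq_intros)
    then have "((\<lambda>x. (max 0 x)\<^sup>2) has_real_derivative 2 * x) (at x)"
      by (rule has_field_derivative_transform_within_open[where S = "{0<..}"]) (use x in auto)
    then show ?thesis using x by simp
  qed
next
  case True
  have "((\<lambda>h. ((max 0 (0 + h))\<^sup>2 - (max 0 0)\<^sup>2) / h) \<longlongrightarrow> 0) (at (0 :: real))"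
  proof (rule Lim_null_comparison[where g = "\<lambda>h. \<bar>h\<bar>"])
    show "\<forall>\<^sub>F h in at 0. norm (((max 0 (0 + h))\<^sup>2 - (max 0 0)\<^sup>2) / h) \<le> \<bar>h :: real\<bar>"
      by (intro always_eventually allI) (auto simp: max_def power2_eq_square)
    show "((\<lambda>h :: real. \<bar>h\<bar>) \<longlongrightarrow> 0) (at 0)"
      using tendsto_rabs[OF tendsto_ident_at[of "0 :: real" UNIV]] by simp
  qed
  then show ?thesis using True by (simp add: DERIV_def)
qed

text \<open>Logarithmic growth of this integral is where dimension two enters. The inner integral is at most
\<open>pi / sqrt (1 + s\<^sup>2)\<close>, whose antiderivative is a multiple of \<open>arsinh\<close>.\<close>

lemma integral_over_square_inverse_quadratic:
  assumes R: "1 \<le> R"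
  shows "integral_over_square R (\<lambda>s t. 1 / (1 + s\<^sup>2 + t\<^sup>2)) \<le> 2 * pi * ln (3 * R)"
proof -
  define h where "h = (\<lambda>s t :: real. 1 / (1 + s\<^sup>2 + t\<^sup>2))"
  have nz: "1 + s\<^sup>2 + t\<^sup>2 \<noteq> 0" for s t :: real
    using zero_le_power2[of s] zero_le_power2[of t] by linarith
  have jh: "jointly_continuous h"
    unfolding jointly_continuous_def h_def by (intro continuous_intros) (use nz in auto)
  have inner: "integral {-R..R} (\<lambda>t. h s t) \<le> pi * (1 / sqrt (s\<^sup>2 + 1))" for s
  proof -
    define a where "a = sqrt (s\<^sup>2 + 1)"
    have a: "0 < a" "a\<^sup>2 = s\<^sup>2 + 1" by (simp_all add: a_def add_nonneg_pos)
    have "((\<lambda>t. h s t) has_integral arctan (R / a) / a - arctan (- R / a) / a) {-R..R}"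
    proof (rule fundamental_theorem_of_calculus)
      show "- R \<le> R" using R by simp
      fix t
      have "((\<lambda>t. arctan (t / a) / a) has_real_derivative inverse (1 + (t / a)\<^sup>2) * (1 / a) / a) (at t within {-R..R})"
        using a(1) by (auto intro!: derivative_eq_intros)
      moreover have "inverse (1 + (t / a)\<^sup>2) * (1 / a) / a = h s t"
      proof -
        have "1 + (t / a)\<^sup>2 = (a\<^sup>2 + t\<^sup>2) / a\<^sup>2" using a(1) by (simp add: add_divide_distrib power_divide)
        moreover have "h s t = 1 / (a\<^sup>2 + t\<^sup>2)" by (simp add: h_def a(2))
        ultimately show ?thesis using a(1) by (simp add: power2_eq_square)
      qed
      ultimately show "((\<lambda>t. arctan (t / a) / a) has_vector_derivative h s t) (at t within {-R..R})"
        by (simp add: has_real_derivative_iff_has_vector_derivative)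
    qed
    then have "integral {-R..R} (\<lambda>t. h s t) = 2 * arctan (R / a) / a"
      by (simp add: integral_unique arctan_minus)
    also have "\<dots> \<le> pi / a"
      using arctan_ubound[of "R / a"] a by (intro divide_right_mono) auto
    finally show ?thesis by (simp add: a_def)
  qed
  have outer: "((\<lambda>s. pi * (1 / sqrt (s\<^sup>2 + 1))) has_integral pi * arsinh R - pi * arsinh (- R)) {-R..R}"
  proof (rule fundamental_theorem_of_calculus)
    show "- R \<le> R" using R by simp
    fix s
    show "((\<lambda>s. pi * arsinh s) has_vector_derivative pi * (1 / sqrt (s\<^sup>2 + 1))) (at s within {-R..R})"
      unfolding has_real_derivative_iff_has_vector_derivative[symmetric]
      by (intro DERIV_cmult arsinh_real_has_field_derivative)
  qed
  have "integral_over_square R h \<le> integral {-R..R} (\<lambda>s. pi * (1 / sqrt (s\<^sup>2 + 1)))"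
    unfolding integral_over_square_def
    by (rule integral_le[OF outer_integrable[OF jh] has_integral_integrable[OF outer] inner])
  also have "\<dots> = 2 * pi * arsinh R"
    using outer by (simp add: integral_unique arsinh_minus_real)
  also have "\<dots> \<le> 2 * pi * ln (3 * R)"
  proof -
    have "sqrt (R\<^sup>2 + 1) \<le> 2 * R"
    proof (rule real_le_lsqrt)
      have "1\<^sup>2 \<le> R\<^sup>2" using R by (intro power_mono) auto
      then show "R\<^sup>2 + 1 \<le> (2 * R)\<^sup>2" by (simp add: power_mult_distrib)
    qed (use R in simp)
    then have "R + sqrt (R\<^sup>2 + 1) \<le> 3 * R" by simp
    moreover have "0 < R + sqrt (R\<^sup>2 + 1)" using R by (simp add: add_pos_nonneg)
    ultimately have "arsinh R \<le> ln (3 * R)" unfolding arsinh_real_def by simp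
    then show ?thesis by (intro mult_left_mono) auto
  qed
  finally show ?thesis by (simp add: h_def)
qed

text \<open>The square makes the positive part continuously differentiable. The cutoff vanishes outside of the disc of
radius \<open>exp (K / 2)\<close>.\<close>

definition log_cutoff :: "real \<Rightarrow> real \<Rightarrow> real \<Rightarrow> real" where
  "log_cutoff K s t = (max 0 (1 - ln (1 + s\<^sup>2 + t\<^sup>2) / K))\<^sup>2"

lemma log_cutoff_boundary:
  assumes K: "0 < K" and r: "exp K \<le> s\<^sup>2 + t\<^sup>2"
  shows "log_cutoff K s t = 0"
proof -
  have "K = ln (exp K)" by simp
  also have "\<dots> \<le> ln (1 + s\<^sup>2 + t\<^sup>2)"
  proof (rule ln_mono)
    show "exp K \<le> 1 + s\<^sup>2 + t\<^sup>2" using r by simp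
  qed simp
  finally have "1 - ln (1 + s\<^sup>2 + t\<^sup>2) / K \<le> 0" using K by simp
  then show ?thesis by (simp add: log_cutoff_def)
qed

lemma log_cutoff_lower:
  assumes K: "4 \<le> K" and "\<bar>s\<bar> \<le> 1" "\<bar>t\<bar> \<le> 1"
  shows "1 / 4 \<le> log_cutoff K s t"
proof -
  have st: "s\<^sup>2 \<le> 1" "t\<^sup>2 \<le> 1" using assms by (simp_all add: abs_square_le_1)
  have "ln (1 + s\<^sup>2 + t\<^sup>2) \<le> (1 + s\<^sup>2 + t\<^sup>2) - 1"
    using zero_le_power2[of s] zero_le_power2[of t] by (intro ln_le_minus_one) linarith
  then have "ln (1 + s\<^sup>2 + t\<^sup>2) \<le> K / 2" using st K by linarith
  then have "1 / 2 \<le> 1 - ln (1 + s\<^sup>2 + t\<^sup>2) / K" using K by (simp add: field_simps)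
  then have "(1 / 2)\<^sup>2 \<le> log_cutoff K s t"
    unfolding log_cutoff_def by (intro power_mono order_trans[OF _ max.cobounded2]) simp_all
  then show ?thesis by (simp add: power2_eq_square)
qed

text \<open>The squared gradient is at most \<open>16 / K\<^sup>2\<close> times \<open>1 / (1 + s\<^sup>2 + t\<^sup>2)\<close>, and the integral of the latter grows only
linearly in \<open>K\<close>.\<close>

lemma log_cutoff_energy:
  assumes K: "4 \<le> K"
  shows "\<exists>\<phi>s \<phi>t. plane_C1 (log_cutoff K) \<phi>s \<phi>t \<and>
    integral_over_square (exp (K / 2)) (\<lambda>s t. (\<phi>s s t)\<^sup>2 + (\<phi>t s t)\<^sup>2) \<le> 256 / K"
proof -
  define r where "r = (\<lambda>s t :: real. 1 + s\<^sup>2 + t\<^sup>2)"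
  define z where "z = (\<lambda>s t. 1 - ln (r s t) / K)"
  have r1: "1 \<le> r s t" for s t by (simp add: r_def)
  have r0: "r s t \<noteq> 0" "0 < r s t" for s t using r1[of s t] by auto
  define \<phi>s where "\<phi>s = (\<lambda>s t. 2 * max 0 (z s t) * (- (2 * s / r s t) / K))"
  define \<phi>t where "\<phi>t = (\<lambda>s t. 2 * max 0 (z s t) * (- (2 * t / r s t) / K))"
  have jr: "continuous_on X (\<lambda>p. r (fst p) (snd p))" for X unfolding r_def by (intro continuous_intros)
  have jz: "continuous_on X (\<lambda>p. z (fst p) (snd p))" for X
    unfolding z_def using r0 K by (intro continuous_intros jr) auto
  have cut: "log_cutoff K = (\<lambda>s t. (max 0 (z s t))\<^sup>2)"
    by (simp add: fun_eq_iff log_cutoff_def z_def r_def)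
  have C1: "plane_C1 (log_cutoff K) \<phi>s \<phi>t"
    unfolding plane_C1_def
  proof (intro conjI allI)
    show "jointly_continuous (log_cutoff K)" "jointly_continuous \<phi>s" "jointly_continuous \<phi>t"
      unfolding jointly_continuous_def cut \<phi>s_def \<phi>t_def using r0 K by (intro continuous_intros jz jr; simp)+
    fix s t
    have "((\<lambda>s. z s t) has_real_derivative - (2 * s / r s t) / K) (at s)"
      unfolding z_def using r0[of s t] K by (auto intro!: derivative_eq_intros simp: r_def)
    from DERIV_chain2[OF pos_part_square_deriv this]
    show "((\<lambda>s. log_cutoff K s t) has_real_derivative \<phi>s s t) (at s)" by (simp add: cut \<phi>s_def)
    have "((\<lambda>t. z s t) has_real_derivative - (2 * t / r s t) / K) (at t)"
      unfolding z_def using r0[of s t] K by (auto intro!: derivative_eq_intros simp: r_def)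
    from DERIV_chain2[OF pos_part_square_deriv this]
    show "((\<lambda>t. log_cutoff K s t) has_real_derivative \<phi>t s t) (at t)" by (simp add: cut \<phi>t_def)
  qed
  have jh: "jointly_continuous (\<lambda>s t. 16 / K\<^sup>2 * (1 / r s t))"
    unfolding jointly_continuous_def using r0 K by (intro continuous_intros jr) auto
  have j: "jointly_continuous \<phi>s" "jointly_continuous \<phi>t" using C1 by (auto simp: plane_C1_def)
  have "integral_over_square (exp (K / 2)) (\<lambda>s t. (\<phi>s s t)\<^sup>2 + (\<phi>t s t)\<^sup>2)
      \<le> integral_over_square (exp (K / 2)) (\<lambda>s t. 16 / K\<^sup>2 * (1 / r s t))"
  proof (rule integral_over_square_mono[OF jointly_continuous_add[OF jointly_continuous_power[OF j(1)] jointly_continuous_power[OF j(2)]] jh])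
    fix s t
    have z1: "z s t \<le> 1" using r1[of s t] K by (simp add: z_def)
    have "(max 0 (z s t))\<^sup>2 \<le> 1" using z1 by (intro power_le_one) auto
    moreover have "(s\<^sup>2 + t\<^sup>2) / (r s t)\<^sup>2 \<le> 1 / r s t"
      using r0[of s t] by (simp add: r_def power2_eq_square divide_simps)
    ultimately have "(max 0 (z s t))\<^sup>2 * ((s\<^sup>2 + t\<^sup>2) / (r s t)\<^sup>2) \<le> 1 * (1 / r s t)"
      by (intro mult_mono) auto
    then have "16 / K\<^sup>2 * ((max 0 (z s t))\<^sup>2 * ((s\<^sup>2 + t\<^sup>2) / (r s t)\<^sup>2)) \<le> 16 / K\<^sup>2 * (1 / r s t)"
      by (intro mult_left_mono) auto
    moreover have "(\<phi>s s t)\<^sup>2 + (\<phi>t s t)\<^sup>2 = 16 / K\<^sup>2 * ((max 0 (z s t))\<^sup>2 * ((s\<^sup>2 + t\<^sup>2) / (r s t)\<^sup>2))"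
      unfolding \<phi>s_def \<phi>t_def by (simp add: power_mult_distrib power_divide add_divide_distrib algebra_simps)
    ultimately show "(\<phi>s s t)\<^sup>2 + (\<phi>t s t)\<^sup>2 \<le> 16 / K\<^sup>2 * (1 / r s t)" by simp
  qed
  also have "\<dots> = 16 / K\<^sup>2 * integral_over_square (exp (K / 2)) (\<lambda>s t. 1 / (1 + s\<^sup>2 + t\<^sup>2))"
    unfolding r_def by (rule integral_over_square_cmult)
  also have "\<dots> \<le> 16 / K\<^sup>2 * (2 * pi * ln (3 * exp (K / 2)))"
    using K by (intro mult_left_mono integral_over_square_inverse_quadratic) auto
  also have "\<dots> \<le> 16 / K\<^sup>2 * (2 * 4 * (2 * K))"
  proof (intro mult_left_mono mult_mono)
    have "ln (3 :: real) \<le> 3 - 1" by (rule ln_le_minus_one) simp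
    then show "ln (3 * exp (K / 2)) \<le> 2 * K" using K by (simp add: ln_mult)
    show "pi \<le> 4" using pi_less_4 by simp
    have "1 \<le> 3 * exp (K / 2)" using one_le_exp_iff[of "K / 2"] K by linarith
    then show "0 \<le> ln (3 * exp (K / 2))" by simp
  qed (use K in auto)
  also have "\<dots> = 256 / K" using K by (simp add: power2_eq_square)
  finally show ?thesis using C1 by blast
qed

text \<open>By homogeneity the constant is the minimum of the form over the unit vectors of the orthant, a compact set.\<close>

lemma strictly_copositive_coercive:
  fixes B :: "real ^ 'n ^ 'n"
  assumes "strictly_copositive B"
  shows "\<exists>\<delta>>0. \<forall>c. (\<forall>i. 0 \<le> c $ i) \<longrightarrow>
    \<delta> * (norm c)\<^sup>2 \<le> (\<Sum>i\<in>UNIV. \<Sum>j\<in>UNIV. B $ i $ j * c $ i * c $ j)"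
proof -
  define Q where "Q = (\<lambda>c :: real ^ 'n. \<Sum>i\<in>UNIV. \<Sum>j\<in>UNIV. B $ i $ j * c $ i * c $ j)"
  define C where "C = sphere 0 1 \<inter> {c :: real ^ 'n. \<forall>i. 0 \<le> c $ i}"
  have Q_scale: "Q (a *\<^sub>R c) = a\<^sup>2 * Q c" for a c
    by (simp add: Q_def sum_distrib_left power2_eq_square ac_simps)
  have "closed {c :: real ^ 'n. \<forall>i. 0 \<le> c $ i}"
    by (intro closed_Collect_all closed_Collect_le continuous_intros)
  then have "compact C" unfolding C_def by (intro compact_Int_closed compact_sphere)
  moreover have "axis undefined 1 \<in> C" by (simp add: C_def, simp add: axis_def)
  moreover have "continuous_on C Q" unfolding Q_def by (intro continuous_intros)
  ultimately obtain c0 where c0: "c0 \<in> C" "\<And>c. c \<in> C \<Longrightarrow> Q c0 \<le> Q c"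
    using continuous_attains_inf[of C Q] by blast
  have "c0 \<noteq> 0" using c0(1) by (auto simp: C_def)
  then have "0 < Q c0"
    using assms c0(1) unfolding strictly_copositive_def nonneg_orthant_def Q_def C_def by auto
  moreover have "Q c0 * (norm c)\<^sup>2 \<le> Q c" if c: "\<forall>i. 0 \<le> c $ i" for c
  proof (cases "c = 0")
    case True
    then show ?thesis by (simp add: Q_def)
  next
    case False
    have "(1 / norm c) *\<^sub>R c \<in> C" using c False by (simp add: C_def)
    then have "Q c0 \<le> (1 / norm c)\<^sup>2 * Q c" using c0(2) Q_scale by metis
    then show ?thesis using False by (simp add: field_simps power_divide)
  qed
  ultimately show ?thesis unfolding Q_def by blast
qed

lemma integral_over_square_lower:
  assumes R: "1 \<le> R" and h: "jointly_continuous h" and nonneg: "\<And>s t. 0 \<le> h s t"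
    and lower: "\<And>s t. \<bar>s\<bar> \<le> 1 \<Longrightarrow> \<bar>t\<bar> \<le> 1 \<Longrightarrow> \<kappa> \<le> h s t"
  shows "4 * \<kappa> \<le> integral_over_square R h"
proof -
  have inner: "2 * \<kappa> \<le> integral {-R..R} (\<lambda>t. h s t)" if s: "\<bar>s\<bar> \<le> 1" for s
  proof -
    have "2 * \<kappa> = integral {-1..1} (\<lambda>t :: real. \<kappa>)" by simp
    also have "\<dots> \<le> integral {-1..1} (\<lambda>t. h s t)"
      by (rule integral_le[OF _ inner_integrable[OF h]]) (use lower s in \<open>auto simp: abs_le_iff\<close>)
    also have "\<dots> \<le> integral {-R..R} (\<lambda>t. h s t)"
      by (rule integral_subset_le[OF _ inner_integrable[OF h] inner_integrable[OF h]]) (use R nonneg in auto)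
    finally show ?thesis .
  qed
  have "4 * \<kappa> = integral {-1..1} (\<lambda>s :: real. 2 * \<kappa>)" by simp
  also have "\<dots> \<le> integral {-1..1} (\<lambda>s. integral {-R..R} (\<lambda>t. h s t))"
    by (rule integral_le[OF _ outer_integrable[OF h]]) (use inner in \<open>auto simp: abs_le_iff\<close>)
  also have "\<dots> \<le> integral_over_square R h"
    unfolding integral_over_square_def
    by (rule integral_subset_le[OF _ outer_integrable[OF h] outer_integrable[OF h]])
      (use R integral_nonneg[OF inner_integrable[OF h] nonneg] in auto)
  finally show ?thesis .
qed

text \<open>The vector \<open>d\<close> of weighted masses satisfies \<open>d\<^sub>k (B d)\<^sub>k \<le> (256 / K) d\<^sub>k\<close> for every \<open>k\<close>, trivially so for components
that vanish. Coercivity turns this into an upper bound for \<open>\<bar>d\<bar>\<close> that tends to zero as \<open>K\<close> grows, whereas a positive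
component keeps a mass that is bounded below independently of \<open>K\<close>.\<close>

theorem planar_liouville:
  fixes B :: "real ^ 'n ^ 'n"
  assumes cop: "strictly_copositive B"
    and U: "\<And>i. plane_C2 (U i) (Us i) (Ut i) (Uss i) (Utt i)"
    and nonneg: "\<And>i s t. 0 \<le> U i s t"
    and eq: "\<And>i s t. - (Uss i s t + Utt i s t) = (\<Sum>j\<in>UNIV. B $ i $ j * (U j s t)\<^sup>2 * U i s t)"
  shows "U i s t = 0"
proof (rule ccontr)
  assume "U i s t \<noteq> 0"
  then have ist: "0 < U i s t" using nonneg[of i s t] by simp
  define V where "V = (\<lambda>i s t. \<Sum>j\<in>UNIV. B $ i $ j * (U j s t)\<^sup>2)"
  have jU: "jointly_continuous (U i)" for i using U[of i] by (simp add: plane_C2_def plane_C1_def)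
  have jV: "jointly_continuous (V i)" for i
    unfolding V_def by (intro jointly_continuous_sum jointly_continuous_mult jointly_continuous_power jointly_continuous_const jU)
  have eqV: "Uss i s t + Utt i s t = - V i s t * U i s t" for i s t
    using eq[of i s t] by (simp add: V_def sum_distrib_right)
  have dichotomy: "0 < U i s' t'" if "0 < U i s t" for i s t s' t'
    by (rule positivity_propagates[OF U jV eqV nonneg that])
  have Upos: "0 < U i s' t'" for s' t' by (rule dichotomy[OF ist])
  obtain \<delta> where \<delta>: "0 < \<delta>" "\<And>c. (\<forall>i. 0 \<le> c $ i) \<Longrightarrow>
    \<delta> * (norm c)\<^sup>2 \<le> (\<Sum>i\<in>UNIV. \<Sum>j\<in>UNIV. B $ i $ j * c $ i * c $ j)"
    using strictly_copositive_coercive[OF cop] by blast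
  have "\<exists>p\<in>{-1..1} \<times> {-1..1}. \<forall>y\<in>{-1..1} \<times> {-1..1}. U i (fst p) (snd p) \<le> U i (fst y) (snd y)"
    by (intro continuous_attains_inf compact_Times compact_Icc continuous_on_subset[OF jU[unfolded jointly_continuous_def]]) auto
  then obtain p where p: "\<And>y. y \<in> {-1..1} \<times> {-1..1} \<Longrightarrow> U i (fst p) (snd p) \<le> U i (fst y) (snd y)"
    by blast
  define \<mu> where "\<mu> = U i (fst p) (snd p)"
  have \<mu>: "0 < \<mu>" "\<And>s t. \<bar>s\<bar> \<le> 1 \<Longrightarrow> \<bar>t\<bar> \<le> 1 \<Longrightarrow> \<mu> \<le> U i s t"
    using Upos p unfolding \<mu>_def by (force simp: abs_le_iff)+
  define N where "N = real CARD('n)"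
  have N: "0 < N" by (simp add: N_def)
  \<comment> \<open>The second entry makes the upper bound \<open>256 N / (K \<delta>)\<close> for \<open>norm d\<close> smaller than the lower bound \<open>\<mu>\<^sup>2 / 4\<close>.\<close>
  define K where "K = max 4 (2048 * N / (\<delta> * \<mu>\<^sup>2))"
  have K: "4 \<le> K" by (simp add: K_def)
  define R where "R = exp (K / 2)"
  have R: "1 \<le> R" using K by (simp add: R_def)
  define \<phi> where "\<phi> = log_cutoff K"
  obtain \<phi>s \<phi>t where \<phi>: "plane_C1 \<phi> \<phi>s \<phi>t"
    and small: "integral_over_square R (\<lambda>s t. (\<phi>s s t)\<^sup>2 + (\<phi>t s t)\<^sup>2) \<le> 256 / K"
    using log_cutoff_energy[OF K] unfolding \<phi>_def R_def by blast
  have j\<phi>: "jointly_continuous \<phi>" using \<phi> by (simp add: plane_C1_def)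
  have RR: "R\<^sup>2 = exp K" unfolding R_def by (simp add: exp_double[symmetric])
  have bd: "\<phi> R t = 0" "\<phi> (- R) t = 0" "\<phi> t R = 0" "\<phi> t (- R) = 0" for t
    unfolding \<phi>_def by (rule log_cutoff_boundary; use K RR in simp)+
  define d where "d = (\<chi> j. integral_over_square R (\<lambda>s t. (U j s t)\<^sup>2 * (\<phi> s t)\<^sup>2))"
  have jd: "jointly_continuous (\<lambda>s t. (U j s t)\<^sup>2 * (\<phi> s t)\<^sup>2)" for j
    by (intro jointly_continuous_mult jointly_continuous_power jU j\<phi>)
  have d0: "0 \<le> d $ j" for j
    unfolding d_def vec_lambda_beta by (rule integral_over_square_nonneg[OF jd]) simp
  have row: "(\<Sum>j\<in>UNIV. B $ k $ j * d $ j) * d $ k \<le> 256 / K * d $ k" for k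
  proof (cases "\<exists>s t. 0 < U k s t")
    case True
    then have Uk: "0 < U k s t" for s t using dichotomy by blast
    have "integral_over_square R (\<lambda>s t. V k s t * (\<phi> s t)\<^sup>2) \<le> 256 / K"
      using positive_supersolution_inequality[OF U Uk jV eqV \<phi> _ bd] R small by (meson order_trans zero_le_one)
    moreover have "integral_over_square R (\<lambda>s t. V k s t * (\<phi> s t)\<^sup>2) = (\<Sum>j\<in>UNIV. B $ k $ j * d $ j)"
    proof -
      have "integral_over_square R (\<lambda>s t. V k s t * (\<phi> s t)\<^sup>2)
          = integral_over_square R (\<lambda>s t. \<Sum>j\<in>UNIV. B $ k $ j * ((U j s t)\<^sup>2 * (\<phi> s t)\<^sup>2))"
        by (simp add: V_def sum_distrib_right mult.assoc)
      also have "\<dots> = (\<Sum>j\<in>UNIV. integral_over_square R (\<lambda>s t. B $ k $ j * ((U j s t)\<^sup>2 * (\<phi> s t)\<^sup>2)))"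
        by (intro integral_over_square_sum jointly_continuous_mult[OF jointly_continuous_const jd]) simp
      finally show ?thesis by (simp add: integral_over_square_cmult d_def)
    qed
    ultimately show ?thesis by (intro mult_right_mono d0) simp
  next
    case False
    then have "U k s t = 0" for s t using nonneg[of k s t] by (meson antisym not_less)
    then have "d $ k = 0" by (simp add: d_def integral_over_square_def)
    then show ?thesis by simp
  qed
  have "\<delta> * (norm d)\<^sup>2 \<le> (\<Sum>k\<in>UNIV. \<Sum>j\<in>UNIV. B $ k $ j * d $ k * d $ j)"
    using \<delta>(2) d0 by blast
  also have "\<dots> = (\<Sum>k\<in>UNIV. (\<Sum>j\<in>UNIV. B $ k $ j * d $ j) * d $ k)"
    unfolding sum_distrib_right by (intro sum.cong refl) (simp add: ac_simps)
  also have "\<dots> \<le> (\<Sum>k\<in>(UNIV :: 'n set). 256 / K * norm d)"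
  proof (rule sum_mono)
    fix k
    have "256 / K * d $ k \<le> 256 / K * norm d"
      using K component_le_norm_cart[of d k] d0[of k] by (intro mult_left_mono) auto
    then show "(\<Sum>j\<in>UNIV. B $ k $ j * d $ j) * d $ k \<le> 256 / K * norm d"
      using row[of k] by linarith
  qed
  also have "\<dots> = N * (256 / K) * norm d" by (simp add: N_def)
  finally have bound: "\<delta> * (norm d)\<^sup>2 \<le> N * (256 / K) * norm d" .
  have "4 * (\<mu>\<^sup>2 / 16) \<le> d $ i"
    unfolding d_def vec_lambda_beta
  proof (rule integral_over_square_lower[OF R jd])
    fix s t :: real assume st: "\<bar>s\<bar> \<le> 1" "\<bar>t\<bar> \<le> 1"
    have "\<mu>\<^sup>2 * (1 / 4)\<^sup>2 \<le> (U i s t)\<^sup>2 * (\<phi> s t)\<^sup>2"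
      unfolding \<phi>_def using \<mu>(1) \<mu>(2)[OF st] log_cutoff_lower[OF K st]
      by (intro mult_mono power_mono) auto
    then show "\<mu>\<^sup>2 / 16 \<le> (U i s t)\<^sup>2 * (\<phi> s t)\<^sup>2" by (simp add: power2_eq_square)
  qed simp
  then have low: "\<mu>\<^sup>2 / 4 \<le> norm d"
    using component_le_norm_cart[of d i] by simp
  moreover have "0 < \<mu>\<^sup>2 / 4" using \<mu> by simp
  ultimately have nd: "0 < norm d" by linarith
  have "\<delta> * norm d * norm d \<le> N * (256 / K) * norm d"
    using bound by (simp only: power2_eq_square mult.assoc)
  then have "\<delta> * norm d \<le> N * (256 / K)" using nd by (rule mult_right_le_imp_le)
  moreover have "\<delta> * (\<mu>\<^sup>2 / 4) \<le> \<delta> * norm d" using low \<delta> by (intro mult_left_mono) auto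
  moreover have "N * (256 / K) < \<delta> * (\<mu>\<^sup>2 / 4)"
  proof -
    have "2048 * N / (\<delta> * \<mu>\<^sup>2) \<le> K" by (simp add: K_def)
    then have "2048 * N \<le> K * (\<delta> * \<mu>\<^sup>2)" using \<delta> \<mu> by (simp add: pos_divide_le_eq)
    then show ?thesis using K N \<delta> \<mu> by (simp add: field_simps)
  qed
  ultimately show False by linarith
qed

text \<open>For two coordinates \<open>e\<close> is the second axis vector; for one coordinate \<open>e = 0\<close>, so the second variable is a
dummy.\<close>

definition plane_chart :: "'m::finite \<Rightarrow> real ^ 'm \<Rightarrow> real \<Rightarrow> real \<Rightarrow> real ^ 'm" where
  "plane_chart a e s t = s *\<^sub>R axis a 1 + t *\<^sub>R e"

lemma derivative_along_axis:
  assumes f: "C1_function f" and shift: "\<And>h. c (x + h) = c x + h *\<^sub>R axis k 1"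
  shows "((\<lambda>x. f (c x)) has_real_derivative partial_deriv k f (c x)) (at x)"
proof -
  have "(\<lambda>t. f (c x + t *\<^sub>R axis k 1)) differentiable (at 0)"
    using f unfolding C1_function_def by blast
  then have "((\<lambda>t. f (c x + t *\<^sub>R axis k 1)) has_real_derivative partial_deriv k f (c x)) (at 0)"
    unfolding partial_deriv_def by (simp add: DERIV_deriv_iff_real_differentiable)
  then have "((\<lambda>t. f (c (x + t))) has_real_derivative partial_deriv k f (c x)) (at 0)"
    by (simp only: shift)
  then show ?thesis using DERIV_shift[of "\<lambda>x. f (c x)" "partial_deriv k f (c x)" 0 x]
    by (simp add: add.commute)
qed

text \<open>\<open>C1_function\<close> asserts the continuity of the partial derivatives only; the continuity of the function
itself follows from its total differentiability.\<close>

lemma jointly_continuous_if_partial_derivatives: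
  assumes fs: "\<And>s t. ((\<lambda>s. f s t) has_real_derivative fs s t) (at s)"
    and ft: "\<And>s t. ((\<lambda>t. f s t) has_real_derivative ft s t) (at t)" and cont: "jointly_continuous ft"
  shows "jointly_continuous f"
proof -
  have "isCont (\<lambda>(s, t). f s t) p" for p
  proof -
    obtain s t where p: "p = (s, t)" by (cases p)
    have "((\<lambda>(s, t). f s t) has_derivative (\<lambda>(h, k). fs s t * h + blinfun_apply (ft s t *\<^sub>R id_blinfun) k))
        (at (s, t) within UNIV \<times> UNIV)"
    proof (rule has_derivative_partialsI)
      show "((\<lambda>s. f s t) has_derivative (*) (fs s t)) (at s within UNIV)"
        using fs by (simp add: has_field_derivative_def)
      show "((\<lambda>y. f x y) has_derivative blinfun_apply (ft x y *\<^sub>R id_blinfun)) (at y within UNIV)" for x y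
      proof -
        have "(*) (ft x y) = blinfun_apply (ft x y *\<^sub>R id_blinfun)"
          by (simp add: fun_eq_iff blinfun.scaleR_left)
        then show ?thesis using ft[of x y] by (simp only: has_field_derivative_def)
      qed
      have "continuous_on UNIV (\<lambda>(x, y). ft x y *\<^sub>R (id_blinfun :: real \<Rightarrow>\<^sub>L real))"
        using cont unfolding jointly_continuous_def case_prod_beta by (intro continuous_intros)
      then show "continuous (at (s, t) within UNIV \<times> UNIV) (\<lambda>(x, y). ft x y *\<^sub>R (id_blinfun :: real \<Rightarrow>\<^sub>L real))"
        by (simp only: UNIV_Times_UNIV continuous_on_eq_continuous_within) blast
    qed simp_all
    from has_derivative_continuous[OF this] show ?thesis unfolding p by simp
  qed
  then show ?thesis unfolding jointly_continuous_def case_prod_beta by (intro continuous_at_imp_continuous_on ballI) simp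
qed

lemma jointly_continuous_plane_chart: "continuous_on UNIV g \<Longrightarrow> jointly_continuous (\<lambda>s t. g (plane_chart a e s t))"
  unfolding jointly_continuous_def plane_chart_def by (rule continuous_on_compose2) (auto intro!: continuous_intros)

lemma planar_restriction:
  assumes "CARD('m::finite) \<in> {1, 2}"
  shows "\<exists>E :: real \<Rightarrow> real \<Rightarrow> real ^ 'm. (\<forall>x. \<exists>s t. x = E s t) \<and>
    (\<forall>f. C2_function f \<longrightarrow> (\<exists>fs ft fss ftt. plane_C2 (\<lambda>s t. f (E s t)) fs ft fss ftt \<and>
      (\<forall>s t. fss s t + ftt s t = laplacian f (E s t))))"
proof (cases "CARD('m) = 1")
  case True
  then obtain a :: 'm where a: "UNIV = {a}" by (metis card_1_singletonE)
  let ?E = "plane_chart a 0"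
  have "\<exists>s t. x = ?E s t" for x
    by (rule exI[of _ "x $ a"]) (use a in \<open>auto simp: plane_chart_def vec_eq_iff axis_def\<close>)
  moreover have "\<exists>fs ft fss ftt. plane_C2 (\<lambda>s t. f (?E s t)) fs ft fss ftt \<and>
      (\<forall>s t. fss s t + ftt s t = laplacian f (?E s t))" if f: "C2_function f" for f
  proof (intro exI conjI allI)
    let ?d = "partial_deriv a f" and ?dd = "partial_deriv a (partial_deriv a f)"
    have C1: "C1_function f" "C1_function ?d" using f by (auto simp: C2_function_def)
    have shift: "?E (s + h) t = ?E s t + h *\<^sub>R axis a 1" for s t h by (simp add: plane_chart_def algebra_simps)
    have d: "((\<lambda>s. f (?E s t)) has_real_derivative ?d (?E s t)) (at s)" for s t
      by (rule derivative_along_axis[OF C1(1) shift])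
    have dd: "((\<lambda>s. ?d (?E s t)) has_real_derivative ?dd (?E s t)) (at s)" for s t
      by (rule derivative_along_axis[OF C1(2) shift])
    have const: "((\<lambda>t. f (?E s t)) has_real_derivative 0) (at t)" for s t by (simp add: plane_chart_def)
    have "jointly_continuous (\<lambda>s t. f (?E s t))"
      by (rule jointly_continuous_if_partial_derivatives[OF d const jointly_continuous_const])
    moreover have "jointly_continuous (\<lambda>s t. ?d (?E s t))" "jointly_continuous (\<lambda>s t. ?dd (?E s t))"
      using C1 unfolding C1_function_def by (blast intro: jointly_continuous_plane_chart)+
    ultimately show "plane_C2 (\<lambda>s t. f (?E s t)) (\<lambda>s t. ?d (?E s t)) (\<lambda>s t. 0) (\<lambda>s t. ?dd (?E s t)) (\<lambda>s t. 0)"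
      unfolding plane_C2_def plane_C1_def using d dd const by (auto simp: jointly_continuous_const)
    show "?dd (?E s t) + 0 = laplacian f (?E s t)" for s t by (simp add: laplacian_def a)
  qed
  ultimately show ?thesis by (intro exI[of _ ?E] conjI allI impI)
next
  case False
  then have "CARD('m) = 2" using assms by simp
  then have "\<exists>a b :: 'm. UNIV = {a, b} \<and> a \<noteq> b" by (simp only: card_2_iff)
  then obtain a b :: 'm where ab: "UNIV = {a, b}" "a \<noteq> b" by (elim exE conjE)
  let ?E = "plane_chart a (axis b 1)"
  have "\<exists>s t. x = ?E s t" for x
  proof (intro exI)
    have "x $ k = ?E (x $ a) (x $ b) $ k" for k
    proof -
      have "k \<in> {a, b}" by (simp only: ab(1)[symmetric] UNIV_I)
      then consider "k = a" | "k = b" by auto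
      then show ?thesis using ab(2) by cases (simp_all add: plane_chart_def axis_def)
    qed
    then show "x = ?E (x $ a) (x $ b)" unfolding vec_eq_iff by (rule allI)
  qed
  moreover have "\<exists>fs ft fss ftt. plane_C2 (\<lambda>s t. f (?E s t)) fs ft fss ftt \<and>
      (\<forall>s t. fss s t + ftt s t = laplacian f (?E s t))" if f: "C2_function f" for f
  proof (intro exI conjI allI)
    let ?d = "\<lambda>k. partial_deriv k f" and ?dd = "\<lambda>k. partial_deriv k (partial_deriv k f)"
    have C1: "C1_function f" "C1_function (?d k)" for k using f by (auto simp: C2_function_def)
    have shift: "?E (s + h) t = ?E s t + h *\<^sub>R axis a 1" for s t h
      by (simp add: plane_chart_def scaleR_add_left)
    have shift': "?E s (t + h) = ?E s t + h *\<^sub>R axis b 1" for s t h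
      by (simp add: plane_chart_def scaleR_add_left)
    have d: "((\<lambda>s. f (?E s t)) has_real_derivative ?d a (?E s t)) (at s)" for s t
      by (rule derivative_along_axis[where c = "\<lambda>s. ?E s t", OF C1(1) shift])
    have d': "((\<lambda>t. f (?E s t)) has_real_derivative ?d b (?E s t)) (at t)" for s t
      by (rule derivative_along_axis[where c = "\<lambda>t. ?E s t", OF C1(1) shift'])
    have dd: "((\<lambda>s. ?d a (?E s t)) has_real_derivative ?dd a (?E s t)) (at s)" for s t
      by (rule derivative_along_axis[where c = "\<lambda>s. ?E s t", OF C1(2) shift])
    have dd': "((\<lambda>t. ?d b (?E s t)) has_real_derivative ?dd b (?E s t)) (at t)" for s t
      by (rule derivative_along_axis[where c = "\<lambda>t. ?E s t", OF C1(2) shift'])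
    have jd: "jointly_continuous (\<lambda>s t. ?d k (?E s t))" "jointly_continuous (\<lambda>s t. ?dd k (?E s t))" for k
      using C1(1) C1(2)[of k] unfolding C1_function_def by (blast intro: jointly_continuous_plane_chart)+
    moreover have "jointly_continuous (\<lambda>s t. f (?E s t))"
      by (rule jointly_continuous_if_partial_derivatives[OF d d' jd(1)])
    ultimately show "plane_C2 (\<lambda>s t. f (?E s t)) (\<lambda>s t. ?d a (?E s t)) (\<lambda>s t. ?d b (?E s t))
        (\<lambda>s t. ?dd a (?E s t)) (\<lambda>s t. ?dd b (?E s t))"
      unfolding plane_C2_def plane_C1_def using d d' dd dd' by (intro conjI allI)
    show "?dd a (?E s t) + ?dd b (?E s t) = laplacian f (?E s t)" for s t
      unfolding laplacian_def ab(1) using ab(2) by simp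
  qed
  ultimately show ?thesis by (intro exI[of _ ?E] conjI allI impI)
qed

theorem no_solution_if_strictly_copositive:
  fixes B :: "real ^ 'n ^ 'n" and u :: "'n \<Rightarrow> real ^ 'm \<Rightarrow> real"
  assumes dim: "CARD('m) \<in> {1, 2}" and cop: "strictly_copositive B" and u: "cubic_system_solution B u"
  shows "\<not> nontrivial u"
proof -
  obtain E :: "real \<Rightarrow> real \<Rightarrow> real ^ 'm" where surj: "\<And>x. \<exists>s t. x = E s t"
    and E: "\<And>f. C2_function f \<Longrightarrow> \<exists>fs ft fss ftt. plane_C2 (\<lambda>s t. f (E s t)) fs ft fss ftt \<and>
      (\<forall>s t. fss s t + ftt s t = laplacian f (E s t))"
    using planar_restriction[OF dim] by blast
  have "\<forall>i. \<exists>fs ft fss ftt. plane_C2 (\<lambda>s t. u i (E s t)) fs ft fss ftt \<and>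
      (\<forall>s t. fss s t + ftt s t = laplacian (u i) (E s t))"
    using E u unfolding cubic_system_solution_def by blast
  then obtain us ut uss utt where C2: "\<And>i. plane_C2 (\<lambda>s t. u i (E s t)) (us i) (ut i) (uss i) (utt i)"
    and lap: "\<And>i s t. uss i s t + utt i s t = laplacian (u i) (E s t)"
    by metis
  have "u i (E s t) = 0" for i s t
  proof (rule planar_liouville[OF cop C2])
    show "0 \<le> u i (E s t)" for i s t using u unfolding cubic_system_solution_def by blast
    show "- (uss i s t + utt i s t) = (\<Sum>j\<in>UNIV. B $ i $ j * (u j (E s t))\<^sup>2 * u i (E s t))" for i s t
      using u unfolding lap cubic_system_solution_def by blast
  qed
  then have "u i x = 0" for i x using surj[of x] by auto
  then show ?thesis by (auto simp: nontrivial_def)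
qed

theorem corollary1p2:
  fixes B :: "real ^ 'n ^ 'n"
  assumes "CARD('m) \<in> {1, 2}"
    and "CARD('n) \<ge> 2"
    and "transpose B = B"
    and "\<And>i. B $ i $ i \<ge> 0"
  shows "(\<exists>u :: 'n \<Rightarrow> real ^ 'm \<Rightarrow> real. cubic_system_solution B u \<and> nontrivial u)
           \<longleftrightarrow> \<not> strictly_copositive B"
proof
  assume "\<exists>u :: 'n \<Rightarrow> real ^ 'm \<Rightarrow> real. cubic_system_solution B u \<and> nontrivial u"
  then show "\<not> strictly_copositive B"
    using no_solution_if_strictly_copositive[OF assms(1)] by blast
next
  assume "\<not> strictly_copositive B"
  then show "\<exists>u :: 'n \<Rightarrow> real ^ 'm \<Rightarrow> real. cubic_system_solution B u \<and> nontrivial u"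
    by (rule solution_if_not_strictly_copositive[OF assms(3,4)])
qed

end
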